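(* Let $K\subset\hat{\mathbb{C}}$ be a compactum and $\mathcal{D}$ a monotone decomposition of $K$. Then the hyperspace $\mathcal{D}$ (with the quotient topology) is a Peano space if and only if every element of $\mathcal{D}$ is an $S$-closed continuum.
   Context: For a compactum $K$ and $x\in K$, $S(x)$ is the set of all $y\in K$ for which there do NOT exist two disjoint open sets $U_x,U_y\subset K$ with $x\in U_x$, $y\in U_y$ such that $K\setminus(U_x\cup U_y)$ has at most finitely many components intersecting both $\partial U_x$ and $\partial U_y$. For a continuum $A\subset K$, $S(A)=\bigcup_{x\in A}S(x)$, and $A$ is $S$-closed if $S(A)=A$. A Peano space is a compactum with at most countably many non-degenerate components, each locally connected, and for each $C>0$ only finitely many of diameter $>C$. A monotone decomposition is an (upper semicontinuous) partition into subcontinua. *)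

theory Defs
  imports "HOL-Analysis.Analysis"
begin

definition continuum :: "'a::topological_space set \<Rightarrow> bool" where
  "continuum A \<longleftrightarrow> A \<noteq> {} \<and> compact A \<and> connected A"

definition S_set :: "'a::topological_space set \<Rightarrow> 'a \<Rightarrow> 'a set" where
  "S_set K x = {y \<in> K. \<not> (\<exists>Ux Uy. openin (top_of_set K) Ux \<and> openin (top_of_set K) Uy \<and>
       Ux \<inter> Uy = {} \<and> x \<in> Ux \<and> y \<in> Uy \<and>
       finite {C \<in> components (K - (Ux \<union> Uy)).
                 C \<inter> (top_of_set K frontier_of Ux) \<noteq> {} \<and>
                 C \<inter> (top_of_set K frontier_of Uy) \<noteq> {}})}"

definition S_of_set :: "'a::topological_space set \<Rightarrow> 'a set \<Rightarrow> 'a set" where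
  "S_of_set K A = (\<Union>x\<in>A. S_set K x)"

definition S_closed :: "'a::topological_space set \<Rightarrow> 'a set \<Rightarrow> bool" where
  "S_closed K A \<longleftrightarrow> S_of_set K A = A"

definition monotone_decomposition :: "'a::topological_space set \<Rightarrow> 'a set set \<Rightarrow> bool" where
  "monotone_decomposition K D \<longleftrightarrow>
     \<Union>D = K \<and> (\<forall>d\<in>D. \<forall>e\<in>D. d \<noteq> e \<longrightarrow> d \<inter> e = {}) \<and>
     (\<forall>d\<in>D. continuum d) \<and>
     (\<forall>d\<in>D. \<forall>U. openin (top_of_set K) U \<and> d \<subseteq> U \<longrightarrow>
         openin (top_of_set K) (\<Union>{e\<in>D. e \<subseteq> U}))"

definition decomp_proj :: "'a set set \<Rightarrow> 'a \<Rightarrow> 'a set" where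
  "decomp_proj D x = (THE d. d \<in> D \<and> x \<in> d)"

lemma istopology_decomp:
  "istopology (\<lambda>U. U \<subseteq> D \<and> openin (top_of_set K) {x \<in> K. decomp_proj D x \<in> U})"
proof -
  have e: "{x \<in> K. decomp_proj D x \<in> \<Union>F} = \<Union>((\<lambda>U. {x \<in> K. decomp_proj D x \<in> U}) ` F)" for F
    by blast
  have i: "{x \<in> K. decomp_proj D x \<in> U \<inter> V} =
           {x \<in> K. decomp_proj D x \<in> U} \<inter> {x \<in> K. decomp_proj D x \<in> V}" for U V
    by blast
  have 1: "\<forall>U V. U \<subseteq> D \<and> openin (top_of_set K) {x \<in> K. decomp_proj D x \<in> U} \<longrightarrow>
      V \<subseteq> D \<and> openin (top_of_set K) {x \<in> K. decomp_proj D x \<in> V} \<longrightarrow>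
      U \<inter> V \<subseteq> D \<and> openin (top_of_set K) {x \<in> K. decomp_proj D x \<in> U \<inter> V}"
    unfolding i by blast
  have 2: "\<forall>F. (\<forall>U\<in>F. U \<subseteq> D \<and> openin (top_of_set K) {x \<in> K. decomp_proj D x \<in> U}) \<longrightarrow>
      \<Union>F \<subseteq> D \<and> openin (top_of_set K) {x \<in> K. decomp_proj D x \<in> \<Union>F}"
    unfolding e by auto
  show ?thesis
    unfolding istopology_def using 1 2 by blast
qed

definition decomp_topology :: "'a::topological_space set \<Rightarrow> 'a set set \<Rightarrow> 'a set topology" where
  "decomp_topology K D =
     topology (\<lambda>U. U \<subseteq> D \<and> openin (top_of_set K) {x \<in> K. decomp_proj D x \<in> U})"

lemma openin_decomp_topology:
  "openin (decomp_topology K D) U \<longleftrightarrow>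
     U \<subseteq> D \<and> openin (top_of_set K) {x \<in> K. decomp_proj D x \<in> U}"
  by (simp add: decomp_topology_def istopology_decomp)

definition peano_space :: "'a topology \<Rightarrow> bool" where
  "peano_space X \<longleftrightarrow>
     compact_space X \<and> metrizable_space X \<and>
     countable {C \<in> connected_components_of X. \<not> (\<exists>a. C = {a})} \<and>
     (\<forall>C \<in> connected_components_of X. locally_connected_space (subtopology X C)) \<and>
     (\<exists>M d. Metric_space M d \<and> X = Metric_space.mtopology M d \<and>
        (\<forall>c>0. finite {C \<in> connected_components_of X. \<exists>x\<in>C. \<exists>y\<in>C. d x y > c}))"

end

theory Submission
  imports Defs
begin

text \<open>
  If the quotient is Peano and two points in different elements were related by \<open>S\<close>, infinitely many
  crossing components upstairs would give infinitely many crossing components in one locally connected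
  component of the quotient; points half-way across accumulate, contradicting local connectedness.

  Conversely, let all elements be \<open>S\<close>-closed. It suffices to show that for disjoint closed sets of the
  quotient only finitely many components cross from one to the other. Otherwise pull the situation back
  to \<open>K\<close>, which we may take to be planar, and enlarge the two closed sets to finite unions of open
  balls, with union \<open>O\<close>. Infinitely many components \<open>C\<close> of \<open>K - O\<close> still cross, and their end points
  accumulate at some \<open>x\<close> and \<open>y\<close> in different elements, so \<open>y\<close> is not in \<open>S(x)\<close>. For small boxes \<open>Dx\<close> and
  \<open>Dy\<close> about these points, infinitely many of the pieces \<open>C - (Dx \<union> Dy)\<close> therefore lie in the same
  component \<open>M\<close> of \<open>K - (Dx \<union> Dy)\<close>. As they lie in different components of \<open>K - O\<close>, each of them must
  touch \<open>O\<close> off the boxes, hence one of finitely many convex pieces of \<open>O - (Dx \<union> Dy)\<close>. Three disjoint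
  continua touching \<open>Dx\<close>, \<open>Dy\<close> and the same convex piece \<open>Q\<close> form a planar \<open>K\<^sub>3\<^sub>,\<^sub>3\<close>, which is impossible.
\<close>

subsection \<open>Theta curves and planarity\<close>

text \<open>The obstacle is that the hypothesis is local while the crossings are global. That y lies
  outside S(x) bounds the crossing components left after deleting small neighbourhoods of two
  points, whereas the crossing components at hand arise after deleting the far larger set O, and
  many of them may fuse into one component once O is put back away from the two points. Planarity
  has to exclude this fusion, through the nonplanarity of K(3,3). Open sets are kept convex for its
  sake: a convex set can be replaced by a hub from which straight spokes run, without crossing, to
  the continua that touch it, and finitely many convex pieces let the pigeonhole principle select a
  third hub.

  The set \<open>K\<close> of the theorem lies on the unit sphere of three-space, the model of the
  extended plane. The crossing statement is therefore isolated as \<open>finite_crossings\<close>, a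
  topologically invariant property that can be carried from the plane to a punctured sphere.\<close>

locale theta_curve =
  fixes P1 P2 P3 :: "complex set" and a b z :: complex
  assumes arcs: "\<exists>g. arc g \<and> path_image g = P1 \<and> pathstart g = a \<and> pathfinish g = b"
     "\<exists>g. arc g \<and> path_image g = P2 \<and> pathstart g = a \<and> pathfinish g = b"
     "\<exists>g. arc g \<and> path_image g = P3 \<and> pathstart g = a \<and> pathfinish g = b"
    and int: "P1 \<inter> P2 = {a,b}" "P1 \<inter> P3 = {a,b}" "P2 \<inter> P3 = {a,b}"
    and z: "\<exists>w \<in> P1 - {a,b}. connected_component (-(P2 \<union> P3)) z w"
     "\<exists>w \<in> P2 - {a,b}. connected_component (-(P1 \<union> P3)) z w"
     "\<exists>w \<in> P3 - {a,b}. connected_component (-(P1 \<union> P2)) z w"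
begin

lemma perms: "theta_curve P1 P3 P2 a b z" "theta_curve P3 P1 P2 a b z" "theta_curve P2 P3 P1 a b z"
  unfolding theta_curve_def using arcs int z by (auto simp: Un_commute Int_commute)

lemma ab: "a \<noteq> b"
  using arcs(1) arc_distinct_ends by blast

lemma Jordan:
  "inside (P1 \<union> P2) \<noteq> {}" "open (inside (P1 \<union> P2))" "connected (inside (P1 \<union> P2))"
  "frontier (inside (P1 \<union> P2)) = P1 \<union> P2" "compact (P1 \<union> P2)"
  "connected (outside (P1 \<union> P2))"
proof -
  obtain g h where g: "arc g" "path_image g = P1" "pathstart g = a" "pathfinish g = b"
    and h: "arc h" "path_image h = P2" "pathstart h = a" "pathfinish h = b"
    using arcs by metis
  have s: "simple_path (g +++ reversepath h)"
    using g h int by (intro simple_path_join_loop) (auto simp: arc_reversepath)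
  have i: "path_image (g +++ reversepath h) = P1 \<union> P2"
    using g h by (simp add: path_image_join)
  have l: "pathfinish (g +++ reversepath h) = pathstart (g +++ reversepath h)"
    using g h by simp
  show "inside (P1 \<union> P2) \<noteq> {}" "open (inside (P1 \<union> P2))" "connected (inside (P1 \<union> P2))"
  "frontier (inside (P1 \<union> P2)) = P1 \<union> P2" "connected (outside (P1 \<union> P2))"
    using Jordan_inside_outside[OF s l] unfolding i by auto
  show "compact (P1 \<union> P2)"
    using compact_simple_path_image[OF s] unfolding i .
qed

text \<open>If one arc ran inside the other two, \<open>z\<close> would lie in one of the two halves of their inside and be
  cut off from the arc bounding the other half.\<close>
lemma not_inside: "P3 \<inter> inside (P1 \<union> P2) = {}"
proof (rule ccontr)
  assume ne: "P3 \<inter> inside (P1 \<union> P2) \<noteq> {}"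
  obtain g h k where g: "arc g" "path_image g = P1" "pathstart g = a" "pathfinish g = b"
    and h: "arc h" "path_image h = P2" "pathstart h = a" "pathfinish h = b"
    and k: "arc k" "path_image k = P3" "pathstart k = a" "pathfinish k = b"
    using arcs by metis
  have split: "inside (P1 \<union> P3) \<union> inside (P2 \<union> P3) \<union> (P3 - {a,b}) = inside (P1 \<union> P2)"
    using split_inside_simple_closed_curve[of g a b h k] g h k ab int ne
    by (metis arc_imp_simple_path)
  have P3: "P3 - {a,b} \<subseteq> inside (P1 \<union> P2)"
    using split by blast
  obtain w1 w2 w3 where w: "w1 \<in> P1 - {a,b}" "connected_component (-(P2 \<union> P3)) z w1"
     "w2 \<in> P2 - {a,b}" "connected_component (-(P1 \<union> P3)) z w2"
     "w3 \<in> P3 - {a,b}" "connected_component (-(P1 \<union> P2)) z w3"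
    using z by metis
  have "z \<in> inside (P1 \<union> P2)"
    using inside_same_component w P3 by (metis connected_component_sym subsetD)
  moreover have "z \<notin> P3"
    using w(2) connected_component_in by blast
  ultimately consider "z \<in> inside (P1 \<union> P3)" | "z \<in> inside (P2 \<union> P3)"
    using split by blast
  then show False
  proof cases
    case 1
    then have "w2 \<in> inside (P1 \<union> P3)"
      using w inside_same_component by metis
    then show False using split w(3) inside_no_overlap[of "P1 \<union> P2"] by blast
  next
    case 2
    then have "w1 \<in> inside (P2 \<union> P3)"
      using w inside_same_component by metis
    then show False using split w(1) inside_no_overlap[of "P1 \<union> P2"] by blast
  qed
qed

text \<open>By \<open>not_inside\<close> the connected region inside \<open>P1 \<union> P2\<close>
  misses \<open>P1 \<union> P3\<close>, so one common point forces it wholly inside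
  \<open>P1 \<union> P3\<close>. Its frontier contains \<open>P2\<close>, which then runs inside
  \<open>P1 \<union> P3\<close>, against \<open>not_inside\<close> with the arcs permuted.\<close>

lemma inside_swallows:
  assumes "q \<in> inside (P1 \<union> P2)" "q \<in> inside (P1 \<union> P3)"
  shows False
proof -
  have "inside (P1 \<union> P2) \<inter> (P1 \<union> P3) = {}"
    using not_inside inside_no_overlap[of "P1 \<union> P2"] by blast
  then have "inside (P1 \<union> P2) \<subseteq> -(P1 \<union> P3)" by blast
  then have sub: "inside (P1 \<union> P2) \<subseteq> inside (P1 \<union> P3)"
    using inside_same_component[of "P1 \<union> P3" q] assms Jordan(3)
    by (meson connected_component_maximal connected_component_def subsetI)
  interpret p: theta_curve P1 P3 P2 a b z by (rule perms)
  have "P2 \<subseteq> closure (inside (P1 \<union> P2))"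
    using Jordan(4) by (metis Un_upper2 frontier_def Diff_subset order_trans)
  also have "\<dots> \<subseteq> closure (inside (P1 \<union> P3))"
    by (intro closure_mono sub)
  also have "\<dots> \<subseteq> inside (P1 \<union> P3) \<union> (P1 \<union> P3)"
    using p.Jordan(4) by (metis closure_Un_frontier order_refl)
  finally have "P2 - {a,b} \<subseteq> inside (P1 \<union> P3)"
    using int by blast
  moreover have "P2 - {a,b} \<noteq> {}"
    using z by blast
  ultimately show False using p.not_inside by blast
qed

text \<open>The ends \<open>a\<close>, \<open>b\<close> and the point \<open>z\<close>, which
  reaches each arc while avoiding the other two, form one side of a K(3,3); the three arcs stand for
  the other side. For the contradiction, a point \<open>q\<close> inside
  \<open>P1 \<union> P2\<close> lies inside neither of the other two curves. Neither of these
  therefore separates \<open>q\<close> from a far point \<open>n\<close>, and as they meet in the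
  connected set \<open>P3\<close>, Janiszewski's theorem says that their union does not either. But
  this union contains \<open>P1 \<union> P2\<close>, which does separate them.\<close>

lemma impossible: False
proof -
  obtain q where q: "q \<in> inside (P1 \<union> P2)" using Jordan by blast
  interpret p: theta_curve P1 P3 P2 a b z by (rule perms)
  interpret p': theta_curve P2 P3 P1 a b z by (rule perms)
  have "compact ((P1 \<union> P3) \<union> (P2 \<union> P3))"
    using p.Jordan(5) p'.Jordan(5) by (rule compact_Un)
  then have "outside ((P1 \<union> P3) \<union> (P2 \<union> P3)) \<noteq> {}"
    using compact_imp_bounded outside_bounded_nonempty by blast
  then obtain n where n: "n \<in> outside ((P1 \<union> P3) \<union> (P2 \<union> P3))" by blast
  have q3: "q \<notin> P1" "q \<notin> P2" "q \<notin> P3" using q not_inside inside_no_overlap[of "P1 \<union> P2"] by blast+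
  have n': "n \<in> outside (P1 \<union> P3)" "n \<in> outside (P2 \<union> P3)" "n \<in> outside (P1 \<union> P2)"
    using n outside_mono by (metis (no_types, lifting) Un_upper1 Un_upper2 Un_assoc Un_commute Un_left_commute subsetD)+
  have out: "outside S \<subseteq> -S" for S :: "complex set"
    using outside_no_overlap by blast
  have "connected_component (-(P1 \<union> P3)) q n" if "q \<notin> inside (P1 \<union> P3)"
  proof -
    have "q \<in> outside (P1 \<union> P3)" using that q3 inside_Un_outside[of "P1 \<union> P3"] by blast
    then show ?thesis
      unfolding connected_component_def using n' p.Jordan(6)
      by (intro exI[of _ "outside (P1 \<union> P3)"] conjI out)
  qed
  moreover have "connected_component (-(P2 \<union> P3)) q n" if "q \<notin> inside (P2 \<union> P3)"
  proof -
    have "q \<in> outside (P2 \<union> P3)" using that q3 inside_Un_outside[of "P2 \<union> P3"] by blast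
    then show ?thesis
      unfolding connected_component_def using n' p'.Jordan(6)
      by (intro exI[of _ "outside (P2 \<union> P3)"] conjI out)
  qed
  moreover have "\<not> connected_component (-((P1 \<union> P3) \<union> (P2 \<union> P3))) q n"
  proof
    assume "connected_component (-((P1 \<union> P3) \<union> (P2 \<union> P3))) q n"
    moreover have "-((P1 \<union> P3) \<union> (P2 \<union> P3)) \<subseteq> -(P1 \<union> P2)" by blast
    ultimately have "connected_component (-(P1 \<union> P2)) q n"
      by (metis connected_component_of_subset)
    then have "n \<in> inside (P1 \<union> P2)" using q inside_same_component by metis
    then show False using n'(3) inside_Int_outside by blast
  qed
  moreover have "(P1 \<union> P3) \<inter> (P2 \<union> P3) = P3" using int by blast
  moreover have "connected P3" using arcs(3) connected_path_image arc_imp_path by metis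
  ultimately have "q \<in> inside (P1 \<union> P3) \<or> q \<in> inside (P2 \<union> P3)"
    using Janiszewski[of "P1 \<union> P3" "P2 \<union> P3" q n] p.Jordan(5) p'.Jordan(5) compact_imp_closed
    by metis
  moreover have "theta_curve P2 P1 P3 a b z"
    unfolding theta_curve_def using arcs int z by (auto simp: Un_commute Int_commute)
  ultimately show False
    using inside_swallows q theta_curve.inside_swallows[of P2 P1 P3 a b z q] by (metis Un_commute)
qed

end

text \<open>The radius at a point of \<open>M i\<close> is half its distance to the union of the
  other sets. If balls about \<open>y\<close> in \<open>M i\<close> and \<open>z\<close> in
  \<open>M j\<close> met, \<open>dist y z\<close> would be less than the mean of two numbers that
  are both at most \<open>dist y z\<close>. As \<open>C\<close> is nonempty, so is that union;
  \<open>infdist\<close> to the empty set would be 0 and the radius would vanish.\<close>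

lemma disjoint_thickenings:
  fixes M :: "'i \<Rightarrow> 'a::metric_space set"
  assumes I: "finite I" and cl: "\<And>i. i \<in> I \<Longrightarrow> compact (M i)"
    and int: "\<And>i j. i \<in> I \<Longrightarrow> j \<in> I \<Longrightarrow> i \<noteq> j \<Longrightarrow> M i \<inter> M j = C"
    and two: "\<And>i. i \<in> I \<Longrightarrow> I - {i} \<noteq> {}" and C: "C \<noteq> {}"
  obtains r where "\<And>i z. i \<in> I \<Longrightarrow> z \<in> M i - C \<Longrightarrow> r i z > (0::real)"
    "\<And>i. i \<in> I \<Longrightarrow> (\<Union>z\<in>M i - C. ball z (r i z)) \<inter> C = {}"
    "\<And>i j. i \<in> I \<Longrightarrow> j \<in> I \<Longrightarrow> i \<noteq> j \<Longrightarrow>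
       (\<Union>z\<in>M i - C. ball z (r i z)) \<inter> (\<Union>z\<in>M j - C. ball z (r j z)) = {}"
proof -
  define A where "A i = \<Union>(M ` (I - {i}))" for i
  have A: "closed (A i)" if "i \<in> I" for i
    unfolding A_def using I cl that by (intro closed_Union) (auto intro: compact_imp_closed)
  have CM: "C \<subseteq> M i" if "i \<in> I" for i
    using int[of i] two[OF that] that by blast
  have CA: "C \<subseteq> A i" if "i \<in> I" for i
    using two[OF that] CM unfolding A_def by blast
  have le: "infdist z (A i) \<le> dist z z'" if "i \<in> I" "j \<in> I" "i \<noteq> j" "z' \<in> M j" for i j z z'
    by (rule infdist_le) (use that in \<open>auto simp: A_def\<close>)
  show ?thesis
  proof (rule that[of "\<lambda>i z. infdist z (A i) / 2"])
    show "infdist z (A i) / 2 > 0" if "i \<in> I" "z \<in> M i - C" for i z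
    proof -
      have "z \<notin> A i" using int that unfolding A_def by blast
      then show ?thesis
        using A[OF that(1)] CA[OF that(1)] C in_closed_iff_infdist_zero[of "A i" z] infdist_nonneg[of z "A i"]
        by fastforce
    qed
    show "(\<Union>z\<in>M i - C. ball z (infdist z (A i) / 2)) \<inter> C = {}" if "i \<in> I" for i
    proof -
      have "infdist z (A i) \<le> dist z c" if "c \<in> C" for z c
        by (rule infdist_le) (use that CA \<open>i \<in> I\<close> in blast)
      moreover have "\<not> dist z c < infdist z (A i) / 2" if "infdist z (A i) \<le> dist z c" for z c
        using that zero_le_dist[of z c] by argo
      ultimately show ?thesis by (auto simp: mem_ball)
    qed
    show "(\<Union>z\<in>M i - C. ball z (infdist z (A i) / 2)) \<inter> (\<Union>z\<in>M j - C. ball z (infdist z (A j) / 2)) = {}"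
      if ij: "i \<in> I" "j \<in> I" "i \<noteq> j" for i j
    proof (rule ccontr)
      assume "\<not> ?thesis"
      then obtain w y z where w: "y \<in> M i" "z \<in> M j" "dist y w < infdist y (A i) / 2"
          "dist z w < infdist z (A j) / 2"
        by auto
      have "infdist y (A i) \<le> dist y z" "infdist z (A j) \<le> dist z y"
        using le ij w by blast+
      then show False
        using w dist_triangle2[of y z w] by (simp add: dist_commute)
    qed
  qed
qed

text \<open>Replacing the continua by disjoint open thickenings yields three arcs from \<open>c 0\<close> to \<open>c 1\<close>; the point
  \<open>c 2\<close> then contradicts the previous results on theta curves.\<close>
lemma no_three_continua_through_three_points:
  fixes M :: "nat \<Rightarrow> complex set" and c :: "nat \<Rightarrow> complex" and I :: "nat set"
  defines "I \<equiv> {0, 1, 2}"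
  assumes comp: "\<And>i. i \<in> I \<Longrightarrow> compact (M i)"
    and conn: "\<And>i. i \<in> I \<Longrightarrow> connected (M i - c ` I)"
    and inj: "inj_on c I"
    and int: "\<And>i j. i \<in> I \<Longrightarrow> j \<in> I \<Longrightarrow> i \<noteq> j \<Longrightarrow> M i \<inter> M j = c ` I"
    and acc: "\<And>i j. i \<in> I \<Longrightarrow> j \<in> I \<Longrightarrow> \<exists>p. p \<noteq> c j \<and> closed_segment (c j) p - {c j} \<subseteq> M i - c ` I"
  shows False
proof -
  define C where "C = c ` I"
  have two: "I - {i} \<noteq> {}" for i unfolding I_def by (cases "i = 0") auto
  obtain r where r: "\<And>i z. i \<in> I \<Longrightarrow> z \<in> M i - C \<Longrightarrow> r i z > (0::real)"
    "\<And>i. i \<in> I \<Longrightarrow> (\<Union>z\<in>M i - C. ball z (r i z)) \<inter> C = {}"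
    "\<And>i j. i \<in> I \<Longrightarrow> j \<in> I \<Longrightarrow> i \<noteq> j \<Longrightarrow>
       (\<Union>z\<in>M i - C. ball z (r i z)) \<inter> (\<Union>z\<in>M j - C. ball z (r j z)) = {}"
    by (rule disjoint_thickenings[of I M C]) (use comp int two in \<open>auto simp: C_def I_def\<close>)
  define V where "V i = (\<Union>z\<in>M i - C. ball z (r i z))" for i
  have MV: "M i - C \<subseteq> V i" if "i \<in> I" for i
    using r(1)[OF that] unfolding V_def by force
  have opV: "open (V i)" for i unfolding V_def by auto
  have connV: "connected (V i)" if i: "i \<in> I" for i
  proof -
    have "connected ((M i - C) \<union> \<Union>((\<lambda>z. ball z (r i z)) ` (M i - C)))"
    proof (rule connected_Un_UN)
      show "connected (M i - C)" using conn[OF i] by (simp add: C_def)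
      fix X assume "X \<in> (\<lambda>z. ball z (r i z)) ` (M i - C)"
      then obtain z where z: "z \<in> M i - C" "X = ball z (r i z)" by blast
      show "connected X" using z by simp
      have "z \<in> X" using z r(1)[OF i] by simp
      then show "(M i - C) \<inter> X \<noteq> {}" using z by blast
    qed
    moreover have "(M i - C) \<union> \<Union>((\<lambda>z. ball z (r i z)) ` (M i - C)) = V i"
      using MV[OF i] unfolding V_def by blast
    ultimately show ?thesis by simp
  qed
  have VC: "V i \<inter> C = {}" if "i \<in> I" for i using r(2)[OF that] unfolding V_def .
  have VV: "V i \<inter> V j = {}" if "i \<in> I" "j \<in> I" "i \<noteq> j" for i j
    using r(3)[OF that] unfolding V_def .
  \<comment> \<open>Connectedness of the open set \<open>V i\<close> gives paths inside it but none
    ending at \<open>c j\<close>, which lies outside \<open>V i\<close>. The segment from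
    \<open>acc\<close> supplies this last stretch.\<close>
  have reach: "path_component (insert (c j) (V i)) (c j) x" if i: "i \<in> I" and j: "j \<in> I" and x: "x \<in> V i" for i j x
  proof -
    obtain p where p: "p \<noteq> c j" "closed_segment (c j) p - {c j} \<subseteq> M i - C"
      using acc[OF i j] C_def by blast
    have pV: "p \<in> V i" using p MV[OF i] by (metis Diff_iff ends_in_segment(2) singletonD subsetD)
    have "closed_segment (c j) p \<subseteq> insert (c j) (V i)" using p MV[OF i] by blast
    then have "path_component (insert (c j) (V i)) (c j) p"
      unfolding path_component_def by (intro exI[of _ "linepath (c j) p"]) auto
    moreover have "path_component (V i) p x"
      using opV connV[OF i] pV x by (metis connected_open_path_connected path_connected_component)
    then have "path_component (insert (c j) (V i)) p x"
      by (meson path_component_of_subset subset_insertI)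
    ultimately show ?thesis by (rule path_component_trans)
  qed
  have ne: "V i \<noteq> {}" if i: "i \<in> I" for i
    using acc[OF i i] MV[OF i] by (metis C_def Diff_iff emptyE ends_in_segment(2) singletonD subsetD)
  have mem: "0 \<in> I" "1 \<in> I" "2 \<in> I" by (auto simp: I_def)
  have c01: "c 0 \<noteq> c 1" "c 2 \<noteq> c 0" "c 2 \<noteq> c 1" using inj mem by (auto dest: inj_onD)
  have arc: "\<exists>g. arc g \<and> path_image g \<subseteq> V i \<union> {c 0, c 1} \<and> pathstart g = c 0 \<and> pathfinish g = c 1" if i: "i \<in> I" for i
  proof -
    obtain x where "x \<in> V i" using ne[OF i] by blast
    then have "path_component (insert (c 0) (V i)) (c 0) x" "path_component (insert (c 1) (V i)) (c 1) x"
      using reach i mem by blast+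
    then have "path_component (V i \<union> {c 0, c 1}) (c 0) x" "path_component (V i \<union> {c 0, c 1}) x (c 1)"
      by (auto intro: path_component_of_subset path_component_sym)
    then have "path_component (V i \<union> {c 0, c 1}) (c 0) (c 1)"
      by (rule path_component_trans)
    then obtain p where "path p" "path_image p \<subseteq> V i \<union> {c 0, c 1}" "pathstart p = c 0" "pathfinish p = c 1"
      unfolding path_component_def by blast
    then show ?thesis using c01(1) path_contains_arc by (metis order_trans)
  qed
  then obtain g where g: "\<And>i. i \<in> I \<Longrightarrow> arc (g i) \<and> path_image (g i) \<subseteq> V i \<union> {c 0, c 1} \<and>
      pathstart (g i) = c 0 \<and> pathfinish (g i) = c 1"
    by metis
  define P where "P i = path_image (g i)" for i
  have P: "P i \<subseteq> V i \<union> {c 0, c 1}" "{c 0, c 1} \<subseteq> P i" if "i \<in> I" for i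
    using g[OF that] pathstart_in_path_image[of "g i"] pathfinish_in_path_image[of "g i"]
    unfolding P_def by auto
  have Pint: "P i \<inter> P j = {c 0, c 1}" if "i \<in> I" "j \<in> I" "i \<noteq> j" for i j
    using P[of i] P[of j] VV[OF that] that by blast
  \<comment> \<open>Here \<open>c 2\<close> takes the role of \<open>z\<close>: adding it to
    \<open>V k\<close> keeps a connected set, which misses the other two arcs because these leave
    their own regions only at \<open>c 0\<close> and \<open>c 1\<close>.\<close>
  have Pz: "\<exists>w \<in> P k - {c 0, c 1}. connected_component (-(P i \<union> P j)) (c 2) w"
    if k: "k \<in> I" "i \<in> I" "j \<in> I" "i \<noteq> k" "j \<noteq> k" for i j k
  proof -
    have "P k - {c 0, c 1} \<noteq> {}"
      using nonempty_simple_path_endless[of "g k"] g[OF k(1)] arc_imp_simple_path unfolding P_def by metis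
    then obtain w where w: "w \<in> P k - {c 0, c 1}" by blast
    then have "w \<in> V k" using P[OF k(1)] by blast
    then have "connected_component (insert (c 2) (V k)) (c 2) w"
      using reach[OF k(1) mem(3)] path_component_subset_connected_component by blast
    moreover have "insert (c 2) (V k) \<subseteq> -(P i \<union> P j)"
    proof -
      have "c ` I \<inter> V l = {}" if "l \<in> I" for l using VC[OF that] C_def by blast
      then have "c 2 \<notin> P i" "c 2 \<notin> P j" "c 0 \<notin> V k" "c 1 \<notin> V k" using k P mem c01 by blast+
      then show ?thesis using P(1)[of i] P(1)[of j] VV[of k i] VV[of k j] k by blast
    qed
    ultimately show ?thesis using w connected_component_of_subset by metis
  qed
  have "theta_curve (P 0) (P 1) (P 2) (c 0) (c 1) (c 2)"
  proof
    show "\<exists>h. arc h \<and> path_image h = P 0 \<and> pathstart h = c 0 \<and> pathfinish h = c 1"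
      "\<exists>h. arc h \<and> path_image h = P 1 \<and> pathstart h = c 0 \<and> pathfinish h = c 1"
      "\<exists>h. arc h \<and> path_image h = P 2 \<and> pathstart h = c 0 \<and> pathfinish h = c 1"
      unfolding P_def using g mem by blast+
  qed (use Pint Pz mem in auto)
  then show False by (rule theta_curve.impossible)
qed

lemma open_convex_segment:
  fixes D :: "'a::euclidean_space set"
  assumes "open D" "convex D" "c \<in> D" "p \<in> closure D"
  shows "open_segment c p \<subseteq> D"
  using in_interior_closure_convex_segment[of D c p] assms by (simp add: interior_open)

text \<open>Each \<open>D j\<close> is replaced by a hub \<open>c j\<close> in it, and each
  \<open>N i\<close> is extended by three straight spokes from its touching points to the hubs. By
  convexity a spoke stays in \<open>D j\<close> up to its touching point, so the extended continua
  meet only in the hubs, and the segments required by the preceding lemma are the spokes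
  themselves.\<close>

lemma no_planar_K33:
  fixes D N :: "nat \<Rightarrow> complex set" and I :: "nat set"
  defines "I \<equiv> {0, 1, 2}"
  assumes D: "\<And>j. j \<in> I \<Longrightarrow> open (D j)" "\<And>j. j \<in> I \<Longrightarrow> convex (D j)" "\<And>j. j \<in> I \<Longrightarrow> D j \<noteq> {}"
    and DD: "\<And>i j. i \<in> I \<Longrightarrow> j \<in> I \<Longrightarrow> i \<noteq> j \<Longrightarrow> D i \<inter> D j = {}"
    and N: "\<And>i. i \<in> I \<Longrightarrow> compact (N i)" "\<And>i. i \<in> I \<Longrightarrow> connected (N i)"
    and NN: "\<And>i j. i \<in> I \<Longrightarrow> j \<in> I \<Longrightarrow> i \<noteq> j \<Longrightarrow> N i \<inter> N j = {}"
    and ND: "\<And>i j. i \<in> I \<Longrightarrow> j \<in> I \<Longrightarrow> N i \<inter> D j = {}"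
    and touch: "\<And>i j. i \<in> I \<Longrightarrow> j \<in> I \<Longrightarrow> N i \<inter> closure (D j) \<noteq> {}"
  shows False
proof -
  have "\<forall>j\<in>I. \<exists>x. x \<in> D j" using D(3) by blast
  then obtain c where c: "\<And>j. j \<in> I \<Longrightarrow> c j \<in> D j" by metis
  have "\<forall>i\<in>I. \<forall>j\<in>I. \<exists>x. x \<in> N i \<inter> closure (D j)" using touch by blast
  then obtain p where p: "\<And>i j. i \<in> I \<Longrightarrow> j \<in> I \<Longrightarrow> p i j \<in> N i \<inter> closure (D j)"
    by metis
  have pD: "p i j \<notin> D k" if "i \<in> I" "j \<in> I" "k \<in> I" for i j k using p[of i j] ND[of i k] that by blast
  have cN: "c j \<notin> N i" if "i \<in> I" "j \<in> I" for i j using c[of j] ND[of i j] that by blast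
  have pc: "p i j \<noteq> c k" if "i \<in> I" "j \<in> I" "k \<in> I" for i j k using pD[OF that] c[of k] that by auto
  have seg: "open_segment (c j) (p i j) \<subseteq> D j" if "i \<in> I" "j \<in> I" for i j
    using open_convex_segment[of "D j" "c j" "p i j"] D[of j] c[of j] p[of i j] that by blast
  define s where "s i j = closed_segment (c j) (p i j)" for i j
  have s: "s i j = open_segment (c j) (p i j) \<union> {c j, p i j}" for i j
    unfolding s_def by (simp add: closed_segment_eq_open)
  have sD: "s i j - {p i j} \<subseteq> D j" if "i \<in> I" "j \<in> I" for i j
    using seg[OF that] c[of j] that unfolding s by blast
  have cseg: "c j \<notin> open_segment (c j) q" for j q by (simp add: open_segment_def)
  have s_cap: "s i j \<inter> s i' j = {c j}" if i: "i \<in> I" "i' \<in> I" "i \<noteq> i'" "j \<in> I" for i i' j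
  proof -
    have aux: "open_segment (c j) (p i j) \<inter> s i' j = {}" if i: "i \<in> I" "i' \<in> I" "i \<noteq> i'" for i i'
    proof (rule ccontr)
      assume "\<not> ?thesis"
      then obtain q where q: "q \<in> open_segment (c j) (p i j)" "q \<in> s i' j" by blast
      have qD: "q \<in> D j" using seg \<open>j \<in> I\<close> i q by blast
      have "q \<noteq> p i' j" using qD pD[of i' j j] \<open>j \<in> I\<close> i by auto
      moreover have "q \<noteq> c j" using q cseg by metis
      ultimately have q': "q \<in> open_segment (c j) (p i' j)" using q s by blast
      obtain t where t: "0 < t" "t < 1" "q = (1 - t) *\<^sub>R c j + t *\<^sub>R p i j"
        using q(1) by (auto simp: in_segment)
      obtain u where u: "0 < u" "u < 1" "q = (1 - u) *\<^sub>R c j + u *\<^sub>R p i' j"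
        using q' by (auto simp: in_segment)
      have eq: "t *\<^sub>R (p i j - c j) = u *\<^sub>R (p i' j - c j)" using t u by (simp add: algebra_simps)
      \<comment> \<open>Two spokes of one hub that share a further point lie on the same ray. The
        end of the shorter one is then interior to the longer one and hence in \<open>D j\<close>,
        whereas touching points belong to some \<open>N\<close> and so avoid
        \<open>D j\<close>.\<close>
      have key: "p b j \<in> D j" if "a \<in> I" "b \<in> I" "0 < x" "x < y" "x *\<^sub>R (p a j - c j) = y *\<^sub>R (p b j - c j)" for a b x y
      proof -
        have "p b j - c j = (x / y) *\<^sub>R (p a j - c j)"
        proof -
          have "(x / y) *\<^sub>R (p a j - c j) = inverse y *\<^sub>R (x *\<^sub>R (p a j - c j))"
            by (simp add: divide_inverse mult.commute)
          also have "\<dots> = p b j - c j" using that by simp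
          finally show ?thesis by simp
        qed
        then have "p b j = (1 - x / y) *\<^sub>R c j + (x / y) *\<^sub>R p a j" by (simp add: algebra_simps)
        moreover have "c j \<noteq> p a j" using pc[of a j j] that \<open>j \<in> I\<close> by auto
        ultimately have "p b j \<in> open_segment (c j) (p a j)"
          using that unfolding in_segment by (intro conjI exI[of _ "x / y"]) auto
        then show ?thesis using seg[of a j] that \<open>j \<in> I\<close> by blast
      qed
      have "p i j \<noteq> p i' j" using p[of i j] p[of i' j] NN[of i i'] i \<open>j \<in> I\<close> by auto
      then have "t \<noteq> u" using eq t by auto
      then consider "t < u" | "u < t" by linarith
      then show False
      proof cases
        case 1
        then show False using key[of i i' t u] eq t(1) i pD[of i' j j] \<open>j \<in> I\<close> by simp
      next
        case 2
        then show False using key[of i' i u t] eq u(1) i pD[of i j j] \<open>j \<in> I\<close> by simp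
      qed
    qed
    have "p i j \<noteq> p i' j" using p[of i j] p[of i' j] NN[of i i'] i by auto
    then show ?thesis
      using aux[of i i'] aux[of i' i] i unfolding s by blast
  qed
  define M where "M i = N i \<union> (\<Union>j\<in>I. s i j)" for i
  have inj: "inj_on c I" 
  proof (rule inj_onI)
    show "i = j" if "i \<in> I" "j \<in> I" "c i = c j" for i j
      using that c[of i] c[of j] DD[of i j] by auto
  qed
  have sC: "s i j \<inter> c ` I = {c j}" if ij: "i \<in> I" "j \<in> I" for i j
  proof -
    have "c k \<notin> s i j" if "k \<in> I" "k \<noteq> j" for k
      using sD[OF ij] c[OF that(1)] DD[of k j] that ij pc[of i j k] by auto
    then show ?thesis using s[of i j] ij by auto
  qed
  have sub: "s i j - {c j} \<subseteq> M i - c ` I" if "i \<in> I" "j \<in> I" for i j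
    using sC[OF that] that unfolding M_def by blast
  have Meq: "M i - c ` I = N i \<union> (\<Union>j\<in>I. s i j - {c j})" if i: "i \<in> I" for i
    using sC[OF i] cN[OF i] unfolding M_def by blast
  show False
  proof (rule no_three_continua_through_three_points[of M c, folded I_def])
    fix i assume i: "i \<in> I"
    show "compact (M i)"
      unfolding M_def s_def using N(1)[OF i] by (intro compact_Un compact_UN) (auto simp: I_def)
    show "connected (M i - c ` I)"
      unfolding Meq[OF i]
    proof (rule connected_Un_UN[OF N(2)[OF i]])
      fix X assume "X \<in> (\<lambda>j. s i j - {c j}) ` I"
      then obtain j where j: "j \<in> I" "X = s i j - {c j}" by blast
      have pcj: "c j \<noteq> p i j" using pc[of i j j] i j by auto
      have Xeq: "X = insert (p i j) (open_segment (c j) (p i j))"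
        using pcj cseg unfolding j(2) s by blast
      show "connected X"
      proof (rule connected_intermediate_closure)
        show "connected (open_segment (c j) (p i j))" by (simp add: convex_connected)
        show "open_segment (c j) (p i j) \<subseteq> X" unfolding Xeq by blast
        show "X \<subseteq> closure (open_segment (c j) (p i j))"
          using pcj open_closed_segment unfolding Xeq by (auto simp: closure_open_segment)
      qed
      show "N i \<inter> X \<noteq> {}" using p[OF i j(1)] Xeq by blast
    qed
  next
    fix i j assume ij: "i \<in> I" "j \<in> I" "i \<noteq> j"
    have "x \<in> c ` I" if x: "x \<in> M i" "x \<in> M j" for x
    proof -
      have NS: "N a \<inter> s b k = {}" if "a \<in> I" "b \<in> I" "a \<noteq> b" "k \<in> I" for a b k
      proof -
        have "N a \<inter> D k = {}" "p b k \<notin> N a" using ND[of a k] p[of b k] NN[of a b] that by auto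
        then show ?thesis using sD[of b k] that by blast
      qed
      consider "x \<in> N i" "x \<in> N j" | k where "k \<in> I" "x \<in> N i" "x \<in> s j k" 
        | k where "k \<in> I" "x \<in> N j" "x \<in> s i k" | k l where "k \<in> I" "l \<in> I" "x \<in> s i k" "x \<in> s j l"
        using x unfolding M_def by blast
      then show ?thesis
      proof cases
        case (4 k l)
        have "k = l"
        proof (rule ccontr)
          assume "k \<noteq> l"
          have "x \<in> D k \<or> x = p i k" "x \<in> D l \<or> x = p j l"
            using sD[of i k] sD[of j l] 4 ij by blast+
          moreover have "p i k \<noteq> p j l" using p[of i k] p[of j l] NN[of i j] 4 ij by auto
          ultimately show False
            using DD[of k l] pD[of i k l] pD[of j l k] \<open>k \<noteq> l\<close> 4 ij by blast
        qed
        then show ?thesis using s_cap[of i j k] ij 4 by auto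
      next
        case 1
        then show ?thesis using NN[of i j] ij by auto
      next
        case (2 k)
        then show ?thesis using NS[of i j k] ij by auto
      next
        case (3 k)
        then show ?thesis using NS[of j i k] ij by auto
      qed
    qed
    moreover have "c ` I \<subseteq> M i" "c ` I \<subseteq> M j" unfolding M_def s by blast+
    ultimately show "M i \<inter> M j = c ` I" by blast
  next
    fix i j assume ij: "i \<in> I" "j \<in> I"
    show "\<exists>p. p \<noteq> c j \<and> closed_segment (c j) p - {c j} \<subseteq> M i - c ` I"
      using sub[OF ij] pc[of i j j] ij unfolding s_def by blast
  qed (rule inj)
qed

subsection \<open>Components crossing between open sets\<close>

text \<open>In a compact Hausdorff space components and quasi-components agree, so sets that no
  component joins can be parted by clopen sets. Both boundary bumping lemmas below rest on
  this.\<close>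

lemma components_separated:
  fixes Y :: "'a::metric_space set"
  assumes Y: "compact Y" and S: "closed S" and T: "closed T"
    and no: "\<And>C. C \<in> components Y \<Longrightarrow> C \<inter> S = {} \<or> C \<inter> T = {}"
  obtains A B where "closed A" "closed B" "A \<union> B = Y" "A \<inter> B = {}" "Y \<inter> S \<subseteq> A" "Y \<inter> T \<subseteq> B"
proof -
  have "separated_between (top_of_set Y) (Y \<inter> S) (Y \<inter> T)"
  proof (rule cut_wire_fence_theorem)
    show "compact_space (top_of_set Y)" using Y by (simp add: compact_space_subtopology)
    show "Hausdorff_space (top_of_set Y)" by (simp add: Hausdorff_space_subtopology Hausdorff_space_euclidean)
    show "closedin (top_of_set Y) (Y \<inter> S)" "closedin (top_of_set Y) (Y \<inter> T)"
      using S T by (auto simp: closedin_closed_Int)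
    fix C assume "connectedin (top_of_set Y) C"
    then have C: "connected C" "C \<subseteq> Y" by (auto simp: connectedin_subtopology)
    show "disjnt C (Y \<inter> S) \<or> disjnt C (Y \<inter> T)"
    proof (cases "C = {}")
      case False
      then obtain P where "P \<in> components Y" "C \<subseteq> P"
        using C exists_component_superset[of C Y] by blast
      then show ?thesis using no unfolding disjnt_def by blast
    qed (simp add: disjnt_def)
  qed
  then obtain A B where AB: "closedin (top_of_set Y) A" "closedin (top_of_set Y) B" "A \<union> B = Y"
      "disjnt A B" "Y \<inter> S \<subseteq> A" "Y \<inter> T \<subseteq> B"
    unfolding separated_between_alt by auto
  moreover have "closed A" "closed B"
    using AB(1,2) Y compact_imp_closed closedin_closed_trans by blast+
  ultimately show ?thesis using that unfolding disjnt_def by blast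
qed

lemma no_separation:
  assumes "connected M" "closed A" "closed B" "M = A \<union> B" "A \<inter> B = {}" "A \<noteq> {}" "B \<noteq> {}"
  shows False
  using assms unfolding connected_closed by blast

lemma closure_in_openin:
  assumes "openin (top_of_set M) U" "U \<inter> V = {}" "V \<subseteq> M"
  shows "U \<inter> closure V = {}"
proof -
  obtain T where T: "open T" "U = M \<inter> T" using assms(1) by (auto simp: openin_open)
  then have "T \<inter> V = {}" using assms by blast
  then have "T \<inter> closure V = {}" using T(1) by (simp add: open_Int_closure_eq_empty)
  then show ?thesis using T by blast
qed

lemma openin_restrict_subset:
  assumes "openin (top_of_set K) U" "M \<subseteq> K"
  shows "openin (top_of_set M) (M \<inter> U)"
  using assms unfolding openin_open by blast

lemma compact_diff_openin:
  assumes "compact M" "openin (top_of_set M) U"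
  shows "compact (M - U)"
proof -
  obtain T where "open T" "U = M \<inter> T" using assms(2) by (auto simp: openin_open)
  then show ?thesis using assms(1) by (simp add: Diff_Int compact_diff)
qed

text \<open>If no component crossed, the remainder would split into closed sets \<open>A\<close> and
  \<open>B\<close> containing its points in the closures of \<open>U\<close> and of
  \<open>V\<close>. A point of \<open>closure U\<close> outside \<open>U\<close> is not in
  \<open>V\<close> either, so it falls into \<open>A\<close>. Thus \<open>U \<union> A\<close> is
  closed, likewise \<open>V \<union> B\<close>, and the two disconnect \<open>M\<close>.\<close>

lemma crossing_component:
  fixes M :: "'a::metric_space set"
  assumes M: "compact M" "connected M"
    and U: "openin (top_of_set M) U" "U \<noteq> {}" and V: "openin (top_of_set M) V" "V \<noteq> {}"
    and UV: "U \<inter> V = {}"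
  obtains R where "R \<in> components (M - (U \<union> V))" "R \<inter> closure U \<noteq> {}" "R \<inter> closure V \<noteq> {}"
proof (rule ccontr)
  note found = that
  assume neg: "\<not> thesis"
  have sub: "U \<subseteq> M" "V \<subseteq> M" using U V openin_imp_subset by auto
  have opUV: "openin (top_of_set M) (U \<union> V)" using U V by blast
  then have "compact (M - (U \<union> V))"
    using M(1) compact_diff_openin by blast
  moreover have "C \<inter> closure U = {} \<or> C \<inter> closure V = {}" if "C \<in> components (M - (U \<union> V))" for C
    using neg found that by blast
  ultimately obtain A B where AB: "closed A" "closed B" "A \<union> B = M - (U \<union> V)" "A \<inter> B = {}"
      "(M - (U \<union> V)) \<inter> closure U \<subseteq> A" "(M - (U \<union> V)) \<inter> closure V \<subseteq> B"
    using components_separated[of "M - (U \<union> V)" "closure U" "closure V"] closed_closure by metis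
  have clM: "closed M" using M compact_imp_closed by blast
  have "closure U \<subseteq> M" "closure V \<subseteq> M" using clM sub closure_minimal by blast+
  moreover have "V \<inter> closure U = {}" "U \<inter> closure V = {}"
    using closure_in_openin[OF V(1), of U] closure_in_openin[OF U(1), of V] UV sub by blast+
  ultimately have "U \<union> A = closure U \<union> A" "V \<union> B = closure V \<union> B"
    using AB closure_subset[of U] closure_subset[of V] by blast+
  then have "closed (U \<union> A)" "closed (V \<union> B)" using AB by auto
  then show False
  proof (rule no_separation[OF M(2)])
    show "M = U \<union> A \<union> (V \<union> B)" using AB(3) sub by blast
    show "(U \<union> A) \<inter> (V \<union> B) = {}" using AB(3,4) UV by blast
  qed (use U V in auto)
qed

text \<open>A component away from \<open>closure U\<close> could be enclosed in a closed part
  \<open>A\<close> of the remainder whose complement \<open>U \<union> B\<close> in \<open>M\<close>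
  is closed as well, and \<open>M\<close> would be disconnected.\<close>

lemma component_touches_removed_open:
  fixes M :: "'a::metric_space set"
  assumes M: "compact M" "connected M"
    and U: "openin (top_of_set M) U" "U \<noteq> {}" and R: "R \<in> components (M - U)"
  shows "R \<inter> closure U \<noteq> {}"
proof
  assume e: "R \<inter> closure U = {}"
  have sub: "U \<subseteq> M" using U openin_imp_subset by auto
  have c: "compact (M - U)"
    using M(1) U compact_diff_openin by blast
  then have clR: "closed R" using R closed_components compact_imp_closed by blast
  have "C \<inter> R = {} \<or> C \<inter> closure U = {}" if "C \<in> components (M - U)" for C
    using e that R components_eq by blast
  then obtain A B where AB: "closed A" "closed B" "A \<union> B = M - U" "A \<inter> B = {}"
      "(M - U) \<inter> R \<subseteq> A" "(M - U) \<inter> closure U \<subseteq> B"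
    using components_separated[OF c clR, of "closure U"] closed_closure by metis
  have "closure U \<subseteq> M" using M sub compact_imp_closed closure_minimal by blast
  then have "U \<union> B = closure U \<union> B" using AB closure_subset[of U] by blast
  then have "closed (U \<union> B)" using AB by auto
  moreover have "R \<noteq> {}" "R \<subseteq> M - U"
    using in_components_nonempty[OF R] in_components_subset[OF R] by auto
  ultimately show False
    using no_separation[OF M(2), of "U \<union> B" A] AB U sub by blast
qed

lemma compact_component:
  fixes K :: "'a::metric_space set"
  assumes "compact K" "C \<in> components K"
  shows "compact C"
proof -
  have "closed C" "C \<subseteq> K" using assms closed_components compact_imp_closed in_components_subset by blast+
  then show ?thesis using compact_Int_closed[OF assms(1), of C] by (simp add: Int_absorb1)
qed

lemma frontier_of_openin:
  assumes "openin (top_of_set K) U"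
  shows "top_of_set K frontier_of U = K \<inter> closure U - U"
  using assms openin_imp_subset[OF assms]
  by (simp add: frontier_of_def interior_of_openin closure_of_subtopology Int_absorb1)

text \<open>Choosing one member of \<open>\<R>\<close> inside each member of \<open>\<M>\<close> is
  injective by disjointness. In this way finiteness passes between families of components of
  different sets.\<close>

lemma finite_if_refined:
  assumes "finite \<R>" and ref: "\<And>M. M \<in> \<M> \<Longrightarrow> \<exists>R\<in>\<R>. R \<noteq> {} \<and> R \<subseteq> M"
    and disj: "\<And>M M'. M \<in> \<M> \<Longrightarrow> M' \<in> \<M> \<Longrightarrow> M \<inter> M' \<noteq> {} \<Longrightarrow> M = M'"
  shows "finite \<M>"
proof -
  have "\<forall>M\<in>\<M>. \<exists>R. R \<in> \<R> \<and> R \<noteq> {} \<and> R \<subseteq> M" using ref by blast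
  then obtain f where f: "\<forall>M\<in>\<M>. f M \<in> \<R> \<and> f M \<noteq> {} \<and> f M \<subseteq> M" by (rule bchoice[THEN exE])
  have "inj_on f \<M>"
  proof (rule inj_onI)
    fix M M' assume *: "M \<in> \<M>" "M' \<in> \<M>" "f M = f M'"
    have "f M \<noteq> {}" "f M \<subseteq> M" "f M' \<subseteq> M'" using f * by blast+
    then have "M \<inter> M' \<noteq> {}" using *(3) by blast
    then show "M = M'" using disj * by blast
  qed
  moreover have "f ` \<M> \<subseteq> \<R>" using f by blast
  ultimately show ?thesis using assms(1) inj_on_finite by blast
qed

text \<open>By boundary bumping, every component crossing between \<open>U\<close> and \<open>V\<close> after removing less contains one
  after removing more.\<close>
lemma finite_crossings_antimono:
  fixes K :: "'a::metric_space set"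
  assumes K: "compact K" and U: "openin (top_of_set K) U" and V: "openin (top_of_set K) V"
    and UV: "U \<inter> V = {}" and W: "openin (top_of_set K) W" "W \<subseteq> U \<union> V"
    and fin: "finite {R \<in> components (K - (U \<union> V)). R \<inter> closure U \<noteq> {} \<and> R \<inter> closure V \<noteq> {}}"
      (is "finite ?R")
  shows "finite {M \<in> components (K - W). M \<inter> U \<noteq> {} \<and> M \<inter> V \<noteq> {}}" (is "finite ?M")
proof -
  have KW: "compact (K - W)" using K W(1) compact_diff_openin by blast
  have ex: "\<exists>R\<in>?R. R \<subseteq> M" if M: "M \<in> ?M" for M
  proof -
    have cM: "compact M" "connected M" "M \<subseteq> K - W"
      using M KW compact_component in_components_connected in_components_subset by blast+
    have "openin (top_of_set M) (M \<inter> U)" "openin (top_of_set M) (M \<inter> V)"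
      using U V cM(3) openin_restrict_subset by blast+
    then obtain R0 where R0: "R0 \<in> components (M - (M \<inter> U \<union> M \<inter> V))" "R0 \<inter> closure (M \<inter> U) \<noteq> {}" "R0 \<inter> closure (M \<inter> V) \<noteq> {}"
      using crossing_component[OF cM(1,2), of "M \<inter> U" "M \<inter> V"] M UV by blast
    then have R0': "R0 \<subseteq> M - (U \<union> V)" "connected R0" "R0 \<noteq> {}"
      using in_components_subset in_components_connected in_components_nonempty by fast+
    then obtain R where R: "R \<in> components (K - (U \<union> V))" "R0 \<subseteq> R"
      using exists_component_superset[of R0 "K - (U \<union> V)"] cM(3) by blast
    have "R \<subseteq> M"
      using components_maximal[of M "K - W" R] M R R0' W in_components_connected in_components_subset by blast
    moreover have "R \<inter> closure U \<noteq> {}" "R \<inter> closure V \<noteq> {}"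
      using R0 R closure_mono[of "M \<inter> U" U] closure_mono[of "M \<inter> V" V] by blast+
    ultimately show ?thesis using R by blast
  qed
  show ?thesis
  proof (rule finite_if_refined[OF fin])
    fix M assume M: "M \<in> ?M"
    show "\<exists>R\<in>?R. R \<noteq> {} \<and> R \<subseteq> M"
      using ex[OF M] in_components_nonempty by blast
  next
    fix M M' assume "M \<in> ?M" "M' \<in> ?M" "M \<inter> M' \<noteq> {}"
    then show "M = M'" using components_eq by blast
  qed
qed

subsection \<open>Crossing components in the plane\<close>

text \<open>Injectivity of \<open>f\<close> makes the set of pairs \<open>(f i, g i)\<close>
  infinite; \<open>(x, y)\<close> is a limit point of it in the compact product. Taking pairs makes
  both ends accumulate along the same indices.\<close>

lemma accumulation_pair:
  fixes X :: "'a::metric_space set" and Y :: "'b::metric_space set"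
  assumes inf: "infinite I" and X: "compact X" and Y: "compact Y"
    and f: "f ` I \<subseteq> X" "inj_on f I" and g: "g ` I \<subseteq> Y"
  obtains x y where "x \<in> X" "y \<in> Y"
    "\<And>S T. open S \<Longrightarrow> open T \<Longrightarrow> x \<in> S \<Longrightarrow> y \<in> T \<Longrightarrow> infinite {i \<in> I. f i \<in> S \<and> g i \<in> T}"
proof -
  define h where "h i = (f i, g i)" for i
  have injh: "inj_on h I" using f(2) unfolding h_def inj_on_def by auto
  have "infinite (h ` I)" using inf injh finite_imageD by blast
  moreover have "h ` I \<subseteq> X \<times> Y" using f g h_def by auto
  moreover have "compact (X \<times> Y)" using X Y by (rule compact_Times)
  ultimately obtain z where z: "z \<in> X \<times> Y" "z islimpt (h ` I)"
    using Heine_Borel_imp_Bolzano_Weierstrass by blast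
  obtain x y where xy: "z = (x, y)" by (cases z)
  show ?thesis
  proof (rule that[of x y])
    show "x \<in> X" "y \<in> Y" using z xy by auto
    fix S T assume "open S" "open T" "x \<in> S" "y \<in> T"
    then have "infinite ((S \<times> T) \<inter> h ` I)"
      using z(2) xy unfolding islimpt_eq_acc_point by (auto intro: open_Times)
    moreover have "(S \<times> T) \<inter> h ` I \<subseteq> h ` {i \<in> I. f i \<in> S \<and> g i \<in> T}"
      unfolding h_def by auto
    ultimately show "infinite {i \<in> I. f i \<in> S \<and> g i \<in> T}"
      using finite_surj by blast
  qed
qed

text \<open>Boxes are used because the complement of a closed box is a union of four half-planes, so removing
  boxes from convex sets leaves finitely many convex pieces.\<close>
lemma box_neighbourhood:
  fixes x :: complex
  assumes "open T" "x \<in> T"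
  obtains D \<H> where "open D" "convex D" "x \<in> D" "closure D \<subseteq> T" "finite \<H>"
    "\<And>H. H \<in> \<H> \<Longrightarrow> open H \<and> convex H" "\<Union>\<H> = - closure D"
proof -
  obtain a b where ab: "cbox a b \<subseteq> T" "x \<in> box a b"
    using open_contains_cbox[OF assms] by metis
  have cl: "closure (box a b) = cbox a b" using ab(2) by (intro closure_box) blast
  let ?\<H> = "{{z. Re z < Re a}, {z. Re b < Re z}, {z. Im z < Im a}, {z. Im b < Im z}}"
  show ?thesis
  proof (rule that[of "box a b" ?\<H>])
    show "\<Union>?\<H> = - closure (box a b)"
      unfolding cl by (auto simp: in_cbox_complex_iff)
    show "open H \<and> convex H" if "H \<in> ?\<H>" for H
      using that by (auto simp: open_halfspace_Re_lt open_halfspace_Re_gt open_halfspace_Im_lt open_halfspace_Im_gt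
          convex_halfspace_Re_lt convex_halfspace_Re_gt convex_halfspace_Im_lt convex_halfspace_Im_gt)
  qed (use ab cl in auto)
qed

lemma no_three_crossing_components:
  fixes K :: "complex set"
  assumes K: "compact K"
    and Dx: "open Dx" "convex Dx" "Dx \<noteq> {}" and Dy: "open Dy" "convex Dy" "Dy \<noteq> {}"
    and Q: "open Q" "convex Q" and DD: "Dx \<inter> Dy = {}" and QD: "Q \<inter> Dx = {}" "Q \<inter> Dy = {}"
    and L: "L \<subseteq> K - (Dx \<union> Dy \<union> Q)" and inf: "infinite \<N>"
    and N: "\<And>N. N \<in> \<N> \<Longrightarrow> N \<in> components L" "\<And>N. N \<in> \<N> \<Longrightarrow> compact N"
    and touch: "\<And>N. N \<in> \<N> \<Longrightarrow> N \<inter> closure Dx \<noteq> {} \<and> N \<inter> closure Dy \<noteq> {} \<and> N \<inter> closure Q \<noteq> {}"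
  shows False
proof -
  obtain f :: "nat \<Rightarrow> complex set" where f: "inj f" "range f \<subseteq> \<N>"
    using infinite_countable_subset[OF inf] by blast
  define D where "D = (\<lambda>j::nat. if j = 0 then Dx else if j = 1 then Dy else Q)"
  have fN: "f i \<in> \<N>" for i using f by blast
  have ne: "Q \<noteq> {}" using touch[OF fN] by auto
  show False
  proof (rule no_planar_K33[of D f])
    fix i j :: nat assume "i \<in> {0,1,2}" "j \<in> {0,1,2}" "i \<noteq> j"
    then show "D i \<inter> D j = {}" using DD QD unfolding D_def by (auto simp: Int_commute)
    show "f i \<inter> f j = {}"
      using components_nonoverlap[OF N(1)[OF fN] N(1)[OF fN]] f(1) \<open>i \<noteq> j\<close> by (auto dest: injD)
  next
    fix i j :: nat
    have "f i \<subseteq> L" using N(1)[OF fN] in_components_subset by blast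
    then show "f i \<inter> D j = {}" using L unfolding D_def by auto
    show "f i \<inter> closure (D j) \<noteq> {}" using touch[OF fN[of i]] unfolding D_def by auto
    show "compact (f i)" "connected (f i)" using N[OF fN[of i]] in_components_connected by auto
  qed (use Dx Dy Q ne in \<open>auto simp: D_def\<close>)
qed

text \<open>Both pigeonhole arguments need a finite family: the components in \<open>\<M>\<close>,
  finite because \<open>y\<close> is assumed outside S(x), and the pieces in \<open>\<Q>\<close>,
  finite because \<open>\<O>\<close> consists of finitely many convex sets. They leave infinitely
  many disjoint continua inside one \<open>M\<close> that touch both boxes and one piece
  \<open>Q\<close>.\<close>

lemma planar_S_set:
  fixes K :: "complex set" and \<O> :: "complex set set"
  assumes K: "compact K" and fO: "finite \<O>" and O: "\<And>H. H \<in> \<O> \<Longrightarrow> open H \<and> convex H"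
    and CC: "\<C> \<subseteq> components (K - \<Union>\<O>)" and x: "x \<in> K" and y: "y \<in> K" and xy: "x \<noteq> y"
    and inf: "\<And>S T. open S \<Longrightarrow> open T \<Longrightarrow> x \<in> S \<Longrightarrow> y \<in> T \<Longrightarrow>
       infinite {C \<in> \<C>. C \<inter> S \<noteq> {} \<and> C \<inter> T \<noteq> {}}"
  shows "y \<in> S_set K x"
proof (rule ccontr)
  assume "y \<notin> S_set K x"
  then obtain Ux Uy where U: "openin (top_of_set K) Ux" "openin (top_of_set K) Uy" "Ux \<inter> Uy = {}" "x \<in> Ux" "y \<in> Uy"
    and fin: "finite {C \<in> components (K - (Ux \<union> Uy)).
                 C \<inter> (top_of_set K frontier_of Ux) \<noteq> {} \<and> C \<inter> (top_of_set K frontier_of Uy) \<noteq> {}}"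
    unfolding S_set_def using y by blast
  \<comment> \<open>Components of the remainder miss \<open>Ux\<close> and \<open>Uy\<close>, so for
    them meeting a closure and meeting a relative frontier amount to the same.\<close>
  have finU: "finite {C \<in> components (K - (Ux \<union> Uy)). C \<inter> closure Ux \<noteq> {} \<and> C \<inter> closure Uy \<noteq> {}}"
  proof (rule finite_subset[OF _ fin], rule subsetI)
    fix C assume C: "C \<in> {C \<in> components (K - (Ux \<union> Uy)). C \<inter> closure Ux \<noteq> {} \<and> C \<inter> closure Uy \<noteq> {}}"
    then have "C \<subseteq> K - (Ux \<union> Uy)" using in_components_subset by auto
    then show "C \<in> {C \<in> components (K - (Ux \<union> Uy)).
                 C \<inter> (top_of_set K frontier_of Ux) \<noteq> {} \<and> C \<inter> (top_of_set K frontier_of Uy) \<noteq> {}}"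
      using C frontier_of_openin[OF U(1)] frontier_of_openin[OF U(2)] by auto
  qed
  obtain Tx Ty where T: "open Tx" "Ux = K \<inter> Tx" "open Ty" "Uy = K \<inter> Ty"
    using U(1,2) by (auto simp: openin_open)
  obtain Gx Gy where G: "open Gx" "open Gy" "x \<in> Gx" "y \<in> Gy" "Gx \<inter> Gy = {}"
    using hausdorff[OF xy] by blast
  obtain Dx \<H>x where Dx: "open Dx" "convex Dx" "x \<in> Dx" "closure Dx \<subseteq> Tx \<inter> Gx" and
    Hx: "finite \<H>x" "\<And>H. H \<in> \<H>x \<Longrightarrow> open H \<and> convex H" "\<Union>\<H>x = - closure Dx"
    using box_neighbourhood[of "Tx \<inter> Gx" x] T G U by (metis IntD2 IntI open_Int)
  obtain Dy \<H>y where Dy: "open Dy" "convex Dy" "y \<in> Dy" "closure Dy \<subseteq> Ty \<inter> Gy" and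
    Hy: "finite \<H>y" "\<And>H. H \<in> \<H>y \<Longrightarrow> open H \<and> convex H" "\<Union>\<H>y = - closure Dy"
    using box_neighbourhood[of "Ty \<inter> Gy" y] T G U by (metis IntD2 IntI open_Int)
  have clD: "closure Dx \<inter> closure Dy = {}" using Dx(4) Dy(4) G(5) by blast
  have DD: "Dx \<inter> Dy = {}" using clD closure_subset[of Dx] closure_subset[of Dy] by blast
  define W where "W = K \<inter> (Dx \<union> Dy)"
  have Wop: "openin (top_of_set K) W" unfolding W_def using Dx Dy by (intro openin_open_Int) auto
  have WU: "W \<subseteq> Ux \<union> Uy"
    unfolding W_def T using Dx(4) Dy(4) closure_subset[of Dx] closure_subset[of Dy] by blast
  \<comment> \<open>Finiteness is given for the uncontrolled open sets \<open>Ux\<close> and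
    \<open>Uy\<close>; boundary bumping transfers it to the convex boxes inside them. Members of
    \<open>\<M>\<close> are asked to meet \<open>Ux\<close> and \<open>Uy\<close> rather than the
    boxes, which have been removed from them.\<close>
  define \<M> where "\<M> = {M \<in> components (K - W). M \<inter> Ux \<noteq> {} \<and> M \<inter> Uy \<noteq> {}}"
  have finM: "finite \<M>"
    unfolding \<M>_def by (rule finite_crossings_antimono[OF K U(1,2,3) Wop WU finU])
  define \<Omega> where "\<Omega> = \<Union>\<O>"
  have opO: "open \<Omega>" unfolding \<Omega>_def using O by auto
  define \<C>1 where "\<C>1 = {C \<in> \<C>. C \<inter> Dx \<noteq> {} \<and> C \<inter> Dy \<noteq> {}}"
  have inf1: "infinite \<C>1" unfolding \<C>1_def by (rule inf) (use Dx Dy in auto)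
  have KO: "compact (K - \<Omega>)" using K opO by (rule compact_diff)
  have Ccomp: "C \<in> components (K - \<Omega>)" "compact C" "connected C" "C \<subseteq> K - \<Omega>" if "C \<in> \<C>" for C
    using that CC compact_component[OF KO] in_components_connected in_components_subset
    unfolding \<Omega>_def by blast+
  have "\<forall>C\<in>\<C>1. \<exists>M. M \<in> \<M> \<and> (\<exists>R. R \<subseteq> C \<and> R \<subseteq> M \<and> connected R \<and> R \<inter> closure Dx \<noteq> {} \<and> R \<inter> closure Dy \<noteq> {})"
  proof
    fix C assume C: "C \<in> \<C>1"
    have C0: "C \<in> \<C>" "C \<inter> Dx \<noteq> {}" "C \<inter> Dy \<noteq> {}" using C unfolding \<C>1_def by auto
    have "openin (top_of_set C) (C \<inter> Dx)" "openin (top_of_set C) (C \<inter> Dy)" using Dx Dy by (auto intro: openin_open_Int)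
    then obtain R where R: "R \<in> components (C - (C \<inter> Dx \<union> C \<inter> Dy))" "R \<inter> closure (C \<inter> Dx) \<noteq> {}" "R \<inter> closure (C \<inter> Dy) \<noteq> {}"
      using crossing_component[OF Ccomp(2,3)[OF C0(1)], of "C \<inter> Dx" "C \<inter> Dy"] C0 DD by blast
    have Rs: "R \<subseteq> C - (Dx \<union> Dy)" using in_components_subset[OF R(1)] by auto
    have Rc: "connected R" using R(1) in_components_connected by auto
    have Rx: "R \<inter> closure Dx \<noteq> {}" "R \<inter> closure Dy \<noteq> {}"
      using R(2,3) closure_mono[of "C \<inter> Dx" Dx] closure_mono[of "C \<inter> Dy" Dy] by auto
    have CK: "C \<subseteq> K" using Ccomp(4)[OF C0(1)] by auto
    have "R \<subseteq> K - W" using Rs CK unfolding W_def by auto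
    moreover have "K - W \<noteq> {}" using \<open>R \<subseteq> K - W\<close> Rx by auto
    ultimately obtain M where M: "M \<in> components (K - W)" "R \<subseteq> M"
      using exists_component_superset[OF _ _ Rc] by metis
    have "M \<inter> Ux \<noteq> {}" "M \<inter> Uy \<noteq> {}"
    proof -
      have "R \<subseteq> K" using Rs CK by auto
      then have "R \<inter> closure Dx \<subseteq> M \<inter> Ux" "R \<inter> closure Dy \<subseteq> M \<inter> Uy"
        using M(2) Dx(4) Dy(4) unfolding T by auto
      then show "M \<inter> Ux \<noteq> {}" "M \<inter> Uy \<noteq> {}" using Rx by auto
    qed
    then have "M \<in> \<M>" using M unfolding \<M>_def by simp
    moreover have "R \<subseteq> C" using Rs by blast
    ultimately show "\<exists>M. M \<in> \<M> \<and> (\<exists>R. R \<subseteq> C \<and> R \<subseteq> M \<and> connected R \<and> R \<inter> closure Dx \<noteq> {} \<and> R \<inter> closure Dy \<noteq> {})"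
      using Rc Rx M(2) by (intro exI[of _ M] exI[of _ R] conjI)
  qed
  then obtain m where m: "\<forall>C\<in>\<C>1. m C \<in> \<M> \<and> (\<exists>R. R \<subseteq> C \<and> R \<subseteq> m C \<and> connected R \<and> R \<inter> closure Dx \<noteq> {} \<and> R \<inter> closure Dy \<noteq> {})"
    by (rule bchoice[THEN exE])
  have "finite (m ` \<C>1)" by (rule finite_subset[OF _ finM]) (use m in auto)
  then obtain C0 where C0: "C0 \<in> \<C>1" "infinite {C \<in> \<C>1. m C = m C0}"
    using pigeonhole_infinite[OF inf1] by blast
  define M where "M = m C0"
  define \<C>2 where "\<C>2 = {C \<in> \<C>1. m C = M}"
  have inf2: "infinite \<C>2" using C0 unfolding \<C>2_def M_def by simp
  have MM: "M \<in> \<M>" using m C0 unfolding M_def by blast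
  then have Mcomp: "M \<in> components (K - W)" unfolding \<M>_def by simp
  have KW: "compact (K - W)" using compact_diff_openin[OF K Wop] .
  have Mc: "compact M" "connected M" "M \<subseteq> K - W"
    using compact_component[OF KW Mcomp] in_components_connected[OF Mcomp] in_components_subset[OF Mcomp] by auto
  have C2: "C \<in> \<C>" "C \<in> \<C>1" "m C = M" if "C \<in> \<C>2" for C
    using that unfolding \<C>2_def \<C>1_def by auto
  have exR: "\<exists>R. R \<subseteq> C \<and> R \<subseteq> M \<and> connected R \<and> R \<inter> closure Dx \<noteq> {} \<and> R \<inter> closure Dy \<noteq> {}" if "C \<in> \<C>2" for C
    using m C2[OF that] by metis
  \<comment> \<open>Otherwise the connected set \<open>M\<close> would lie in a single component of
    \<open>K - \<Omega>\<close>, although it contains pieces of infinitely many.\<close>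
  have MO: "M \<inter> \<Omega> \<noteq> {}"
  proof
    assume e: "M \<inter> \<Omega> = {}"
    have eq: "C = C'" if "C \<in> \<C>2" "C' \<in> \<C>2" for C C'
    proof -
      have s: "M \<subseteq> K - \<Omega>" using e Mc(3) by auto
      have "M \<subseteq> C''" if C'': "C'' \<in> \<C>2" for C''
        using components_maximal[OF Ccomp(1)[OF C2(1)[OF C'']] Mc(2) s] exR[OF C''] by auto
      then have "M \<subseteq> C" "M \<subseteq> C'" using that by auto
      moreover have "M \<noteq> {}" using in_components_nonempty[OF Mcomp] by auto
      ultimately show ?thesis
        using components_eq[OF Ccomp(1)[OF C2(1)[OF that(1)]] Ccomp(1)[OF C2(1)[OF that(2)]]] by auto
    qed
    obtain C where "C \<in> \<C>2" using inf2 by (metis finite.emptyI ex_in_conv)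
    then have "\<C>2 \<subseteq> {C}" using eq by auto
    then show False using inf2 finite_subset by auto
  qed
  define L where "L = M - \<Omega>"
  have Lc: "compact L" unfolding L_def using Mc(1) opO by (rule compact_diff)
  \<comment> \<open>Each piece is the intersection of a convex member of \<open>\<O>\<close> with
    one half-plane off each closed box, so it is convex and disjoint from both boxes.\<close>
  define \<Q> where "\<Q> = (\<lambda>(H, H', H''). H \<inter> H' \<inter> H'') ` (\<O> \<times> \<H>x \<times> \<H>y)"
  have finQ: "finite \<Q>" unfolding \<Q>_def using fO Hx Hy by auto
  have Qeq: "\<Union>\<Q> = \<Omega> \<inter> (- closure Dx) \<inter> (- closure Dy)"
    unfolding \<Q>_def \<Omega>_def Hx(3)[symmetric] Hy(3)[symmetric] by auto
  have Qoc: "open Q \<and> convex Q" if Q: "Q \<in> \<Q>" for Q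
    using Q O Hx(2) Hy(2) unfolding \<Q>_def by (auto intro!: open_Int convex_Int)
  \<comment> \<open>An open convex set is the interior of its closure. A point of
    \<open>M \<inter> \<Omega>\<close> is only known to avoid the open boxes, but by this fact it is
    a limit of points off a closed box. As the closed boxes are disjoint, it lies in at most one of
    them, and the limit can be taken for one box at a time.\<close>
  have Dint: "closure (- closure D) = - D" if "open D" "convex D" for D :: "complex set"
    using that convex_interior_closure[of D] by (simp add: closure_complement interior_open)
  have MOsub: "M \<inter> \<Omega> \<subseteq> closure (\<Union>\<Q>)"
  proof
    fix w assume w: "w \<in> M \<inter> \<Omega>"
    then have wD: "w \<in> closure (- closure Dx)" "w \<in> closure (- closure Dy)"
      using Mc(3) Dint Dx Dy unfolding W_def by auto
    show "w \<in> closure (\<Union>\<Q>)"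
    proof (cases "w \<in> closure Dy")
      case True
      then have "w \<in> \<Omega> \<inter> (- closure Dx)" using clD w by auto
      moreover have "open (\<Omega> \<inter> (- closure Dx))" using opO by auto
      ultimately show ?thesis
        using open_Int_closure_subset[of "\<Omega> \<inter> (- closure Dx)" "- closure Dy"] wD unfolding Qeq by auto
    next
      case False
      then have "w \<in> \<Omega> \<inter> (- closure Dy)" using w by auto
      moreover have "open (\<Omega> \<inter> (- closure Dy))" using opO by auto
      ultimately show ?thesis
        using open_Int_closure_subset[of "\<Omega> \<inter> (- closure Dy)" "- closure Dx"] wD unfolding Qeq by (auto simp: Int_ac)
    qed
  qed
  have clQ: "closure (\<Union>\<Q>) = \<Union>(closure ` \<Q>)" using finQ by (induction rule: finite_induct) auto
  \<comment> \<open>The crossing piece of \<open>C\<close> is enlarged to a component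
    \<open>N\<close> of \<open>M - \<Omega>\<close>. It still lies in \<open>C\<close>, so distinct
    \<open>C\<close> keep distinct \<open>N\<close>, and being a full component it must touch the
    removed set \<open>M \<inter> \<Omega>\<close>, which the closures of the pieces cover.\<close>
  have "\<forall>C\<in>\<C>2. \<exists>Q. Q \<in> \<Q> \<and> (\<exists>N. N \<in> components L \<and> N \<subseteq> C \<and> N \<inter> closure Dx \<noteq> {} \<and> N \<inter> closure Dy \<noteq> {} \<and> N \<inter> closure Q \<noteq> {})"
  proof
    fix C assume C: "C \<in> \<C>2"
    obtain R where R: "R \<subseteq> C" "R \<subseteq> M" "connected R" "R \<inter> closure Dx \<noteq> {}" "R \<inter> closure Dy \<noteq> {}"
      using exR[OF C] by blast
    have "R \<subseteq> L" using R Ccomp(4)[OF C2(1)[OF C]] unfolding L_def by auto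
    moreover have "L \<noteq> {}" using \<open>R \<subseteq> L\<close> R by auto
    ultimately obtain N where N: "N \<in> components L" "R \<subseteq> N"
      using exists_component_superset[OF _ _ R(3)] by metis
    have "R \<noteq> {}" using R(4) by auto
    then have CN: "C \<inter> N \<noteq> {}" using R(1) N(2) by auto
    have "N \<subseteq> K - \<Omega>" using in_components_subset[OF N(1)] Mc(3) unfolding L_def by auto
    then have "N \<subseteq> C"
      using components_maximal[OF Ccomp(1)[OF C2(1)[OF C]] in_components_connected[OF N(1)] _ CN] by simp
    have "N \<in> components (M - M \<inter> \<Omega>)" using N(1) unfolding L_def by (simp add: Diff_Int)
    moreover have "openin (top_of_set M) (M \<inter> \<Omega>)" using opO by (rule openin_open_Int)
    ultimately have "N \<inter> closure (M \<inter> \<Omega>) \<noteq> {}"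
      using component_touches_removed_open[OF Mc(1,2) _ MO] by blast
    moreover have "closure (M \<inter> \<Omega>) \<subseteq> closure (\<Union>\<Q>)" using closure_mono[OF MOsub] by simp
    ultimately obtain Q where "Q \<in> \<Q>" "N \<inter> closure Q \<noteq> {}" unfolding clQ by blast
    moreover have "N \<inter> closure Dx \<noteq> {}" "N \<inter> closure Dy \<noteq> {}" using N R by auto
    ultimately show "\<exists>Q. Q \<in> \<Q> \<and> (\<exists>N. N \<in> components L \<and> N \<subseteq> C \<and> N \<inter> closure Dx \<noteq> {} \<and> N \<inter> closure Dy \<noteq> {} \<and> N \<inter> closure Q \<noteq> {})"
      using N(1) \<open>N \<subseteq> C\<close> by (intro exI[of _ Q] exI[of _ N] conjI)
  qed
  then obtain q where q: "\<forall>C\<in>\<C>2. q C \<in> \<Q> \<and> (\<exists>N. N \<in> components L \<and> N \<subseteq> C \<and> N \<inter> closure Dx \<noteq> {} \<and> N \<inter> closure Dy \<noteq> {} \<and> N \<inter> closure (q C) \<noteq> {})"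
    by (rule bchoice[THEN exE])
  have "finite (q ` \<C>2)" by (rule finite_subset[OF _ finQ]) (use q in auto)
  then obtain C3 where C3: "C3 \<in> \<C>2" "infinite {C \<in> \<C>2. q C = q C3}"
    using pigeonhole_infinite[OF inf2] by blast
  define Q where "Q = q C3"
  have QQ: "Q \<in> \<Q>" using q C3 unfolding Q_def by blast
  define \<N> where "\<N> = {N \<in> components L. N \<inter> closure Dx \<noteq> {} \<and> N \<inter> closure Dy \<noteq> {} \<and> N \<inter> closure Q \<noteq> {}}"
  have infN: "infinite \<N>"
  proof
    assume f: "finite \<N>"
    have "finite {C \<in> \<C>2. q C = q C3}"
    proof (rule finite_if_refined[OF f])
      fix C assume C: "C \<in> {C \<in> \<C>2. q C = q C3}"
      then have C': "C \<in> \<C>2" "q C = Q" unfolding Q_def by auto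
      then obtain N where "N \<in> components L" "N \<subseteq> C" "N \<inter> closure Dx \<noteq> {}" "N \<inter> closure Dy \<noteq> {}" "N \<inter> closure Q \<noteq> {}"
        using q by metis
      then show "\<exists>N\<in>\<N>. N \<noteq> {} \<and> N \<subseteq> C" unfolding \<N>_def by auto
    next
      fix C C' assume "C \<in> {C \<in> \<C>2. q C = q C3}" "C' \<in> {C \<in> \<C>2. q C = q C3}" "C \<inter> C' \<noteq> {}"
      then show "C = C'" using components_eq[OF Ccomp(1)[OF C2(1)] Ccomp(1)[OF C2(1)]] by auto
    qed
    then show False using C3 by simp
  qed
  have Qsub: "Q \<subseteq> \<Omega>" "Q \<inter> closure Dx = {}" "Q \<inter> closure Dy = {}" using QQ Qeq by auto
  show False
  proof (rule no_three_crossing_components[OF K Dx(1,2) _ Dy(1,2) _ _ _ DD _ _ _ infN])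
    show "L \<subseteq> K - (Dx \<union> Dy \<union> Q)" using Mc(3) Qsub(1) unfolding L_def W_def by auto
    show "Q \<inter> Dx = {}" "Q \<inter> Dy = {}" using Qsub closure_subset[of Dx] closure_subset[of Dy] by auto
    show "compact N" if "N \<in> \<N>" for N using that compact_component[OF Lc] unfolding \<N>_def by auto
  qed (use Dx Dy Qoc[OF QQ] in \<open>auto simp: \<N>_def\<close>)
qed

text \<open>The removed set \<open>V\<close> lets one property serve two ends: with \<open>V\<close>
  empty it bounds the number of large components, and with \<open>V\<close> the complement of a
  closed ball it gives local connectedness. The neighbourhoods \<open>G\<close> and \<open>H\<close>
  carry the assumption on S, since end points of crossings may accumulate off \<open>E\<close> and
  \<open>F\<close>. Only topological notions occur, so homeomorphisms preserve the property.\<close>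

definition finite_crossings :: "'a::metric_space set \<Rightarrow> bool" where
  "finite_crossings K \<longleftrightarrow> (\<forall>G H E F V.
     openin (top_of_set K) G \<longrightarrow> openin (top_of_set K) H \<longrightarrow> G \<inter> H = {} \<longrightarrow>
     compact E \<longrightarrow> compact F \<longrightarrow> E \<subseteq> G \<longrightarrow> F \<subseteq> H \<longrightarrow>
     openin (top_of_set K) V \<longrightarrow> V \<subseteq> F \<longrightarrow> (\<forall>x\<in>G. \<forall>y\<in>H. y \<notin> S_set K x) \<longrightarrow>
     finite {P \<in> components (K - V). P \<inter> E \<noteq> {} \<and> P \<inter> F \<noteq> {}})"

text \<open>The balls are chosen with their closed balls inside the open set cutting out
  \<open>G\<close>. The closure condition is what keeps accumulation points of crossing ends in
  \<open>G\<close>.\<close>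

lemma finite_ball_cover:
  fixes E :: "'a::euclidean_space set"
  assumes E: "compact E" and G: "openin (top_of_set K) G" and EG: "E \<subseteq> G"
  obtains \<A> where "finite \<A>" "\<And>H. H \<in> \<A> \<Longrightarrow> open H \<and> convex H" "E \<subseteq> \<Union>\<A>" "K \<inter> closure (\<Union>\<A>) \<subseteq> G"
proof -
  obtain T where T: "open T" "G = K \<inter> T" using G by (auto simp: openin_open)
  have "\<forall>z\<in>E. \<exists>r>0. cball z r \<subseteq> T"
    using T EG open_contains_cball by blast
  then obtain r where r: "\<forall>z\<in>E. r z > 0 \<and> cball z (r z) \<subseteq> T" by (rule bchoice[THEN exE])
  obtain Z where Z: "Z \<subseteq> E" "finite Z" "E \<subseteq> (\<Union>z\<in>Z. ball z (r z))"
    by (rule compactE_image[OF E, of E "\<lambda>z. ball z (r z)"]) (use r in force)+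
  show ?thesis
  proof (rule that[of "(\<lambda>z. ball z (r z)) ` Z"])
    have "closure (\<Union>((\<lambda>z. ball z (r z)) ` Z)) \<subseteq> (\<Union>z\<in>Z. cball z (r z))"
      using Z(2) by (intro closure_minimal) (auto simp: less_imp_le)
    also have "\<dots> \<subseteq> T" using r Z(1) by blast
    finally show "K \<inter> closure (\<Union>((\<lambda>z. ball z (r z)) ` Z)) \<subseteq> G" using T(2) by blast
  qed (use Z in auto)
qed

lemma finite_crossings_complex:
  fixes K :: "complex set"
  assumes K: "compact K"
  shows "finite_crossings K"
  unfolding finite_crossings_def
proof (intro allI impI)
  fix G H E F V
  assume G: "openin (top_of_set K) G" and H: "openin (top_of_set K) H" and GH: "G \<inter> H = {}"
    and E: "compact E" "E \<subseteq> G" and F: "compact F" "F \<subseteq> H"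
    and V: "openin (top_of_set K) V" "V \<subseteq> F" and S: "\<forall>x\<in>G. \<forall>y\<in>H. y \<notin> S_set K x"
  obtain \<A> where A: "finite \<A>" "\<And>H. H \<in> \<A> \<Longrightarrow> open H \<and> convex H" "E \<subseteq> \<Union>\<A>" "K \<inter> closure (\<Union>\<A>) \<subseteq> G"
    using finite_ball_cover[OF E(1) G E(2)] by metis
  obtain \<B> where B: "finite \<B>" "\<And>H. H \<in> \<B> \<Longrightarrow> open H \<and> convex H" "F \<subseteq> \<Union>\<B>" "K \<inter> closure (\<Union>\<B>) \<subseteq> H"
    using finite_ball_cover[OF F(1) H F(2)] by metis
  define U where "U = K \<inter> \<Union>\<A>"
  define W where "W = K \<inter> \<Union>\<B>"
  have U: "openin (top_of_set K) U" "openin (top_of_set K) W"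
    unfolding U_def W_def using A(2) B(2) by (auto intro!: openin_open_Int open_Union)
  have clUW: "K \<inter> closure U \<subseteq> G" "K \<inter> closure W \<subseteq> H"
    using A(4) B(4) closure_mono[of U "\<Union>\<A>"] closure_mono[of W "\<Union>\<B>"] unfolding U_def W_def by auto
  have sub: "U \<subseteq> G" "W \<subseteq> H"
    using clUW closure_subset[of U] closure_subset[of W] unfolding U_def W_def by auto
  have UW: "U \<inter> W = {}" using sub GH by auto
  have EK: "E \<subseteq> K" "F \<subseteq> K" using E F openin_imp_subset[OF G] openin_imp_subset[OF H] by auto
  have EU: "E \<subseteq> U" "F \<subseteq> W" using A(3) B(3) EK unfolding U_def W_def by auto
  define \<C> where "\<C> = {R \<in> components (K - (U \<union> W)). R \<inter> closure U \<noteq> {} \<and> R \<inter> closure W \<noteq> {}}"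
  \<comment> \<open>Relatively open sets are traded for convex open sets of the plane, the form in
    which \<open>planar_S_set\<close> expects the removed set.\<close>
  have Keq: "K - (U \<union> W) = K - \<Union>(\<A> \<union> \<B>)" unfolding U_def W_def by auto
  have "finite \<C>"
  proof (rule ccontr)
    assume inf: "infinite \<C>"
    have CK: "C \<subseteq> K" if "C \<in> \<C>" for C
      using that in_components_subset[of C "K - (U \<union> W)"] unfolding \<C>_def by auto
    have "\<forall>C\<in>\<C>. \<exists>p. p \<in> C \<inter> closure U" unfolding \<C>_def by auto
    then obtain f where f: "\<forall>C\<in>\<C>. f C \<in> C \<inter> closure U" by (rule bchoice[THEN exE])
    have "\<forall>C\<in>\<C>. \<exists>p. p \<in> C \<inter> closure W" unfolding \<C>_def by auto
    then obtain g where g: "\<forall>C\<in>\<C>. g C \<in> C \<inter> closure W" by (rule bchoice[THEN exE])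
    have inj: "inj_on f \<C>"
    proof (rule inj_onI)
      fix C C' assume *: "C \<in> \<C>" "C' \<in> \<C>" "f C = f C'"
      have "f C \<in> C" "f C' \<in> C'" using f * by auto
      then have "C \<inter> C' \<noteq> {}" using *(3) by auto
      then show "C = C'" using components_eq[of C "K - (U \<union> W)" C'] * unfolding \<C>_def by auto
    qed
    have fK: "f ` \<C> \<subseteq> K \<inter> closure U" and gK: "g ` \<C> \<subseteq> K \<inter> closure W"
      using f g CK by blast+
    obtain x y where xy: "x \<in> K \<inter> closure U" "y \<in> K \<inter> closure W"
      "\<And>S T. open S \<Longrightarrow> open T \<Longrightarrow> x \<in> S \<Longrightarrow> y \<in> T \<Longrightarrow> infinite {C \<in> \<C>. f C \<in> S \<and> g C \<in> T}"
      by (rule accumulation_pair[OF inf compact_Int_closed[OF K closed_closure] compact_Int_closed[OF K closed_closure] fK inj gK]) (rule that)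
    have GHxy: "x \<in> G" "y \<in> H" using xy(1,2) clUW by auto
    have "y \<in> S_set K x"
    proof (rule planar_S_set[OF K, of "\<A> \<union> \<B>" \<C>])
      show "finite (\<A> \<union> \<B>)" using A B by simp
      show "open H \<and> convex H" if "H \<in> \<A> \<union> \<B>" for H using that A(2) B(2) by auto
      show "\<C> \<subseteq> components (K - \<Union> (\<A> \<union> \<B>))" unfolding Keq[symmetric] \<C>_def by auto
      show "x \<in> K" "y \<in> K" using xy by auto
      show "x \<noteq> y" using GHxy GH by auto
      fix S T :: "complex set" assume "open S" "open T" "x \<in> S" "y \<in> T"
      then have "infinite {C \<in> \<C>. f C \<in> S \<and> g C \<in> T}" by (rule xy(3))
      moreover have "{C \<in> \<C>. f C \<in> S \<and> g C \<in> T} \<subseteq> {C \<in> \<C>. C \<inter> S \<noteq> {} \<and> C \<inter> T \<noteq> {}}"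
        using f g by auto
      ultimately show "infinite {C \<in> \<C>. C \<inter> S \<noteq> {} \<and> C \<inter> T \<noteq> {}}" using finite_subset by auto
    qed
    then show False using S GHxy by auto
  qed
  \<comment> \<open>The count was made after removing the large set \<open>U \<union> W\<close>;
    since \<open>V \<subseteq> F \<subseteq> W\<close>, boundary bumping brings it back to the
    smaller removed set \<open>V\<close>.\<close>
  then have "finite {M \<in> components (K - V). M \<inter> U \<noteq> {} \<and> M \<inter> W \<noteq> {}}"
    unfolding \<C>_def by (rule finite_crossings_antimono[OF K U UW V(1), rotated]) (use V(2) EU in auto)
  then show "finite {P \<in> components (K - V). P \<inter> E \<noteq> {} \<and> P \<inter> F \<noteq> {}}"
    by (rule finite_subset[rotated]) (use EU in auto)
qed

section \<open>Topological invariance, and passage from the plane to the sphere\<close>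

lemma component_homeomorphic_image:
  assumes h: "homeomorphism X Y f g" and C: "C \<in> components X"
  shows "f ` C \<in> components Y"
proof -
  have sub: "C \<subseteq> X" and conn: "connected C" and ne: "C \<noteq> {}"
    using in_components_subset[OF C] in_components_connected[OF C] in_components_nonempty[OF C] by auto
  have "connected (f ` C)" using conn h sub by (meson connected_continuous_image continuous_on_subset homeomorphism_def)
  moreover have fY: "f ` C \<subseteq> Y" using h sub unfolding homeomorphism_def by auto
  ultimately obtain D where D: "D \<in> components Y" "f ` C \<subseteq> D"
    using exists_component_superset[of "f ` C" Y] ne by auto
  have DY: "D \<subseteq> Y" "connected D" using in_components_subset[OF D(1)] in_components_connected[OF D(1)] by auto
  have "connected (g ` D)" using DY h by (meson connected_continuous_image continuous_on_subset homeomorphism_def)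
  moreover have "g ` D \<subseteq> X" using h DY unfolding homeomorphism_def by auto
  moreover have gf: "g (f x) = x" if "x \<in> X" for x using h that by (simp add: homeomorphism_def)
  have "g ` f ` C = C" using gf sub by (force simp: image_image)
  then have "C \<subseteq> g ` D" using D(2) by auto
  then have "C \<inter> g ` D \<noteq> {}" using ne by auto
  ultimately have "g ` D \<subseteq> C" using components_maximal[OF C] by simp
  have "f ` g ` D = D" using h DY(1) by (force simp: image_image homeomorphism_def)
  then have "D \<subseteq> f ` C" using \<open>g ` D \<subseteq> C\<close> by auto
  then show ?thesis using D by auto
qed

lemma homeomorphic_map_of_homeomorphism:
  "homeomorphism X Y f g \<Longrightarrow> homeomorphic_map (top_of_set X) (top_of_set Y) f"
  unfolding homeomorphic_map_maps homeomorphic_maps_def homeomorphism_def by (intro exI[of _ g]) auto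

lemma finite_crossing_image:
  assumes h: "homeomorphism K L f g" and V: "V \<subseteq> K" "E \<subseteq> K" "F \<subseteq> K"
    and fin: "finite {P \<in> components (L - f ` V). P \<inter> f ` E \<noteq> {} \<and> P \<inter> f ` F \<noteq> {}}" (is "finite ?L")
  shows "finite {P \<in> components (K - V). P \<inter> E \<noteq> {} \<and> P \<inter> F \<noteq> {}}" (is "finite ?K")
proof -
  have inj: "inj_on f K" using h by (metis homeomorphism_def inj_on_inverseI)
  have "f ` (K - V) = L - f ` V" using h V inj by (auto simp: homeomorphism_def inj_on_image_set_diff[OF inj])
  then have h': "homeomorphism (K - V) (L - f ` V) f g"
    by (intro homeomorphism_of_subsets[OF h]) auto
  have "(`) f ` ?K \<subseteq> ?L"
    using component_homeomorphic_image[OF h'] by auto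
  moreover have "inj_on ((`) f) ?K"
    by (rule inj_on_subset[OF inj_on_image_Pow[OF inj]]) (use in_components_subset in auto)
  ultimately show ?thesis using fin inj_on_finite by auto
qed

lemma S_set_homeomorphic:
  assumes h: "homeomorphism K L f g" and x: "x \<in> K" and y: "y \<in> K" and nS: "y \<notin> S_set K x"
  shows "f y \<notin> S_set L (f x)"
proof -
  obtain Ux Uy where U: "openin (top_of_set K) Ux" "openin (top_of_set K) Uy" "Ux \<inter> Uy = {}" "x \<in> Ux" "y \<in> Uy"
    and fin: "finite {C \<in> components (K - (Ux \<union> Uy)).
                 C \<inter> (top_of_set K frontier_of Ux) \<noteq> {} \<and> C \<inter> (top_of_set K frontier_of Uy) \<noteq> {}}"
    using nS y unfolding S_set_def by blast
  have inj: "inj_on f K" using h by (metis homeomorphism_def inj_on_inverseI)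
  have sub: "Ux \<subseteq> K" "Uy \<subseteq> K"
    using openin_imp_subset[OF U(1)] openin_imp_subset[OF U(2)] by auto
  have hm: "homeomorphic_map (top_of_set K) (top_of_set L) f" using homeomorphic_map_of_homeomorphism[OF h] .
  have fr: "top_of_set L frontier_of (f ` Ux) = f ` (top_of_set K frontier_of Ux)"
      "top_of_set L frontier_of (f ` Uy) = f ` (top_of_set K frontier_of Uy)"
    using homeomorphic_map_frontier_of[OF hm] sub by auto
  have op: "openin (top_of_set L) (f ` Ux)" "openin (top_of_set L) (f ` Uy)"
    using homeomorphism_imp_open_map[OF h] U by auto
  have h': "homeomorphism L K g f" using h homeomorphism_symD by blast
  have gf: "g ` f ` A = A" if "A \<subseteq> K" for A using h that by (force simp: image_image homeomorphism_def)
  have frs: "top_of_set K frontier_of U \<subseteq> K" for U using frontier_of_subset_topspace[of "top_of_set K" U] by simp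
  \<comment> \<open>Components of the target are counted through the inverse homeomorphism, which
    sends them injectively to components in \<open>K\<close>.\<close>
  have "finite {C \<in> components (L - (f ` Ux \<union> f ` Uy)).
      C \<inter> f ` (top_of_set K frontier_of Ux) \<noteq> {} \<and> C \<inter> f ` (top_of_set K frontier_of Uy) \<noteq> {}}"
  proof (rule finite_crossing_image[OF h'])
    show "finite {P \<in> components (K - g ` (f ` Ux \<union> f ` Uy)).
      P \<inter> g ` f ` (top_of_set K frontier_of Ux) \<noteq> {} \<and> P \<inter> g ` f ` (top_of_set K frontier_of Uy) \<noteq> {}}"
      using fin gf[OF frs] gf[OF sub(1)] gf[OF sub(2)] by (simp add: image_Un)
    have fL: "f ` A \<subseteq> L" if "A \<subseteq> K" for A using h that by (auto simp: homeomorphism_def)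
    show "f ` Ux \<union> f ` Uy \<subseteq> L" "f ` (top_of_set K frontier_of Ux) \<subseteq> L" "f ` (top_of_set K frontier_of Uy) \<subseteq> L"
      using fL[OF sub(1)] fL[OF sub(2)] fL[OF frs] by auto
  qed
  then have "\<exists>Vx Vy. openin (top_of_set L) Vx \<and> openin (top_of_set L) Vy \<and> Vx \<inter> Vy = {} \<and> f x \<in> Vx \<and> f y \<in> Vy \<and>
     finite {C \<in> components (L - (Vx \<union> Vy)). C \<inter> (top_of_set L frontier_of Vx) \<noteq> {} \<and> C \<inter> (top_of_set L frontier_of Vy) \<noteq> {}}"
    using op U(3-5) sub fr inj
    by (intro exI[of _ "f ` Ux"] exI[of _ "f ` Uy"]) (simp add: inj_on_image_Int[OF inj, symmetric])
  then show ?thesis unfolding S_set_def by blast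
qed

lemma finite_crossings_homeomorphic:
  assumes h: "homeomorphism K L f g" and L: "finite_crossings L"
  shows "finite_crossings K"
  unfolding finite_crossings_def
proof (intro allI impI)
  fix G H E F V
  assume G: "openin (top_of_set K) G" and H: "openin (top_of_set K) H" and GH: "G \<inter> H = {}"
    and E: "compact E" and F: "compact F" and EG: "E \<subseteq> G" and FH: "F \<subseteq> H"
    and V: "openin (top_of_set K) V" "V \<subseteq> F" and S: "\<forall>x\<in>G. \<forall>y\<in>H. y \<notin> S_set K x"
  have inj: "inj_on f K" using h by (metis homeomorphism_def inj_on_inverseI)
  have sub: "G \<subseteq> K" "H \<subseteq> K" "V \<subseteq> K"
    using openin_imp_subset[OF G] openin_imp_subset[OF H] openin_imp_subset[OF V(1)] by auto
  have c: "continuous_on K f" using h by (simp add: homeomorphism_def)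
  show "finite {P \<in> components (K - V). P \<inter> E \<noteq> {} \<and> P \<inter> F \<noteq> {}}"
  proof (rule finite_crossing_image[OF h])
    show "finite {P \<in> components (L - f ` V). P \<inter> f ` E \<noteq> {} \<and> P \<inter> f ` F \<noteq> {}}"
    proof (rule L[unfolded finite_crossings_def, rule_format])
      show "openin (top_of_set L) (f ` G)" "openin (top_of_set L) (f ` H)" "openin (top_of_set L) (f ` V)"
        using homeomorphism_imp_open_map[OF h] G H V by auto
      show "f ` G \<inter> f ` H = {}" using inj_on_image_Int[OF inj sub(1,2)] GH by auto
      show "compact (f ` E)" "compact (f ` F)"
        using E F EG FH sub c by (meson compact_continuous_image continuous_on_subset order_trans)+
      fix x y assume "x \<in> f ` G" "y \<in> f ` H"
      then obtain x' y' where "x' \<in> G" "x = f x'" "y' \<in> H" "y = f y'" by auto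
      then show "y \<notin> S_set L x" using S S_set_homeomorphic[OF h, of x' y'] sub by auto
    qed (use EG FH V in auto)
  qed (use sub EG FH in auto)
qed

text \<open>Points of infinitely many crossing components in \<open>E\<close> would accumulate at a
  point of \<open>G\<close>. A connected neighbourhood of it inside \<open>G\<close> misses
  \<open>V\<close> and thus lies in one component. This settles the full sphere, which has no free
  point for a puncture.\<close>

lemma finite_crossings_locally_connected:
  fixes K :: "'a::metric_space set"
  assumes lc: "locally connected K"
  shows "finite_crossings K"
  unfolding finite_crossings_def
proof (intro allI impI)
  fix G H E F V
  assume G: "openin (top_of_set K) G" and H: "openin (top_of_set K) H" and GH: "G \<inter> H = {}"
    and E: "compact E" and F: "compact F" and EG: "E \<subseteq> G" and FH: "F \<subseteq> H"
    and V: "openin (top_of_set K) V" "V \<subseteq> F"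
  show "finite {P \<in> components (K - V). P \<inter> E \<noteq> {} \<and> P \<inter> F \<noteq> {}}" (is "finite ?P")
  proof (rule ccontr)
    assume inf: "infinite ?P"
    have "\<forall>P\<in>?P. \<exists>e. e \<in> P \<inter> E" by auto
    then obtain f where f: "\<forall>P\<in>?P. f P \<in> P \<inter> E" by (rule bchoice[THEN exE])
    have inj: "inj_on f ?P"
    proof (rule inj_onI)
      fix P Q assume *: "P \<in> ?P" "Q \<in> ?P" "f P = f Q"
      have "f P \<in> P" "f Q \<in> Q" using f * by blast+
      then have "P \<inter> Q \<noteq> {}" using *(3) by auto
      then show "P = Q" using components_eq[of P "K - V" Q] * by auto
    qed
    have fE: "f ` ?P \<subseteq> E" using f by blast
    \<comment> \<open>A single accumulation point suffices here, so \<open>f\<close> is supplied for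
      both coordinates and the second neighbourhood is later taken to be
      \<open>UNIV\<close>.\<close>
    obtain e e' where e: "e \<in> E" "e' \<in> E"
      "\<And>S T. open S \<Longrightarrow> open T \<Longrightarrow> e \<in> S \<Longrightarrow> e' \<in> T \<Longrightarrow> infinite {P \<in> ?P. f P \<in> S \<and> f P \<in> T}"
      by (rule accumulation_pair[OF inf E E fE inj fE]) (rule that)
    have "e \<in> G" using e EG by auto
    then obtain u where u: "openin (top_of_set K) u" "connected u" "e \<in> u" "u \<subseteq> G"
      using lc[unfolded locally_connected] G by blast
    obtain T where T: "open T" "u = K \<inter> T" using u(1) by (auto simp: openin_open)
    have "infinite {P \<in> ?P. f P \<in> T}" using e(3)[of T UNIV] T u by auto
    moreover have "{P \<in> ?P. f P \<in> T} \<subseteq> {P}" if P: "P \<in> {P \<in> ?P. f P \<in> T}" for P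
    proof
      fix Q assume Q: "Q \<in> {P \<in> ?P. f P \<in> T}"
      have uV: "u \<subseteq> K - V" using u(4) V(2) FH GH T by auto
      have "f P \<in> P" "f Q \<in> Q" "f P \<in> u" "f Q \<in> u"
        using f P Q EG openin_imp_subset[OF G] T by auto
      then have "u \<subseteq> P" "u \<subseteq> Q"
        using components_maximal[of P "K - V" u] components_maximal[of Q "K - V" u] P Q u(2) uV by auto
      then have "P \<inter> Q \<noteq> {}" using u(3) by auto
      then show "Q \<in> {P}" using components_eq[of P "K - V" Q] P Q by auto
    qed
    moreover from calculation obtain P where "P \<in> {P \<in> ?P. f P \<in> T}"
      by (metis (no_types, lifting) finite.emptyI all_not_in_conv)
    ultimately show False by (metis (no_types, lifting) finite.emptyI finite.insertI finite_subset)
  qed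
qed

text \<open>A proper subset of the sphere embeds in the plane; the full sphere is locally connected.\<close>
lemma finite_crossings_sphere:
  fixes K :: "(real^3) set"
  assumes K: "K \<subseteq> sphere 0 1" "compact K"
  shows "finite_crossings K"
proof (cases "K = sphere 0 1")
  case True
  then show ?thesis using finite_crossings_locally_connected locally_connected_sphere by blast
next
  case False
  then obtain b where b: "b \<in> sphere 0 1" "b \<notin> K" using K by blast
  have b0: "b \<noteq> 0" using b by auto
  have "sphere 0 1 - {b} homeomorphic {x::real^3. b \<bullet> x = 0}"
    using b b0 by (intro homeomorphic_punctured_sphere_hyperplane) auto
  \<comment> \<open>Both are affine sets of dimension 2.\<close>
  also have "{x::real^3. b \<bullet> x = 0} homeomorphic (UNIV :: complex set)"
    using b0 by (intro homeomorphic_affine_sets) (auto simp: affine_hyperplane)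
  finally obtain f g where fg: "homeomorphism (sphere 0 1 - {b}) (UNIV :: complex set) f g"
    unfolding homeomorphic_def by blast
  have h: "homeomorphism K (f ` K) f g"
    by (rule homeomorphism_of_subsets[OF fg]) (use K b in auto)
  moreover have "compact (f ` K)"
    using h K(2) by (metis compact_continuous_image homeomorphism_def)
  ultimately show ?thesis using finite_crossings_homeomorphic finite_crossings_complex by blast
qed

subsection \<open>Recognising Peano spaces\<close>

text \<open>This is Urysohn's embedding: one function for each pair of basic sets with the closure
  of the first in the second. Countably many functions separate points, and compactness makes the
  injective map into the countable power of the line an embedding.\<close>

lemma metrizable_space_compact_second_countable:
  assumes comp: "compact_space X" and haus: "Hausdorff_space X" and sc: "second_countable X"
  shows "metrizable_space X"
proof -
  have normal: "normal_space X" using comp haus compact_Hausdorff_or_regular_imp_normal_space by blast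
  obtain \<B> where B: "countable \<B>" "\<And>V. V \<in> \<B> \<Longrightarrow> openin X V"
    "\<And>U x. openin X U \<Longrightarrow> x \<in> U \<Longrightarrow> \<exists>V\<in>\<B>. x \<in> V \<and> V \<subseteq> U"
    using sc unfolding second_countable_def by auto
  define I where "I = {(A, V). A \<in> \<B> \<and> V \<in> \<B> \<and> X closure_of A \<subseteq> V}"
  have I: "countable I"
    by (rule countable_subset[OF _ countable_SIGMA[OF B(1) B(1)]]) (auto simp: I_def)
  have "\<forall>p\<in>I. \<exists>f. continuous_map X euclideanreal f \<and> f ` (X closure_of (fst p)) \<subseteq> {0} \<and> f ` (topspace X - snd p) \<subseteq> {1}"
  proof
    fix p assume "p \<in> I"
    then have p: "fst p \<in> \<B>" "snd p \<in> \<B>" "X closure_of (fst p) \<subseteq> snd p" unfolding I_def by auto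
    have "closedin X (topspace X - snd p)" using B(2)[OF p(2)] by (simp add: closedin_diff)
    moreover have "disjnt (X closure_of (fst p)) (topspace X - snd p)" using p(3) unfolding disjnt_def by auto
    ultimately show "\<exists>f. continuous_map X euclideanreal f \<and> f ` (X closure_of (fst p)) \<subseteq> {0} \<and> f ` (topspace X - snd p) \<subseteq> {1}"
      using Urysohn_lemma_alt[OF normal closedin_closure_of] by metis
  qed
  then obtain f where f: "\<forall>p\<in>I. continuous_map X euclideanreal (f p) \<and> f p ` (X closure_of (fst p)) \<subseteq> {0} \<and> f p ` (topspace X - snd p) \<subseteq> {1}"
    by (rule bchoice[THEN exE])
  define \<Phi> where "\<Phi> x = (\<lambda>p\<in>I. f p x)" for x
  let ?Y = "product_topology (\<lambda>p. euclideanreal) I"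
  have cont: "continuous_map X ?Y \<Phi>"
    unfolding continuous_map_componentwise using f by (auto simp: \<Phi>_def image_subset_iff)
  have inj: "inj_on \<Phi> (topspace X)"
  proof (rule inj_onI, rule ccontr)
    fix x y assume xy: "x \<in> topspace X" "y \<in> topspace X" "\<Phi> x = \<Phi> y" "x \<noteq> y"
    obtain U where U: "openin X U" "x \<in> U" "y \<notin> U"
      using haus xy unfolding Hausdorff_space_def disjnt_def by blast
    obtain V where V: "V \<in> \<B>" "x \<in> V" "V \<subseteq> U" using B(3)[OF U(1,2)] by blast
    have "regular_space X" using comp haus compact_Hausdorff_imp_regular_space by blast
    then obtain G C where G: "openin X G" "closedin X C" "x \<in> G" "G \<subseteq> C" "C \<subseteq> V"
      using B(2)[OF V(1)] V(2) unfolding neighbourhood_base_of_closedin[symmetric] neighbourhood_base_of by metis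
    obtain A where A: "A \<in> \<B>" "x \<in> A" "A \<subseteq> G" using B(3)[OF G(1,3)] by blast
    have cl: "X closure_of A \<subseteq> V" using A(3) G closure_of_minimal[of A C X] by auto
    then have p: "(A, V) \<in> I" using A V unfolding I_def by auto
    have "A \<subseteq> topspace X" using B(2)[OF A(1)] openin_subset by auto
    then have "x \<in> X closure_of A" using A(2) closure_of_subset by blast
    then have "f (A, V) x = 0" using f p by force
    moreover have "f (A, V) y = 1" using f p xy(2) U(3) V(3) by force
    moreover have "f (A, V) x = f (A, V) y" using fun_cong[OF xy(3), of "(A, V)"] p by (simp add: \<Phi>_def)
    ultimately show False by simp
  qed
  have "Hausdorff_space ?Y" by (simp add: Hausdorff_space_product_topology)
  then have "closed_map X ?Y \<Phi>" using comp cont continuous_imp_closed_map by blast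
  then have "embedding_map X ?Y \<Phi>" using cont inj injective_closed_imp_embedding_map by blast
  then have "X homeomorphic_space (subtopology ?Y (\<Phi> ` topspace X))"
    by (rule embedding_map_imp_homeomorphic_space)
  moreover have "metrizable_space ?Y"
    unfolding metrizable_space_product_topology using I by (auto intro: countable_subset simp: metrizable_space_euclidean)
  ultimately show ?thesis
    using homeomorphic_metrizable_space metrizable_space_subtopology by blast
qed

context Metric_space
begin

text \<open>Take a finite net of mesh \<open>c/4\<close>. If the closed \<open>c/4\<close>-balls
  about the net points near \<open>x\<close> and \<open>y\<close> met, four steps of length at most
  \<open>c/4\<close> would give \<open>d x y \<le> c\<close>. So every large component crosses
  between one of finitely many pairs of disjoint balls.\<close>

lemma finitely_many_large_components:
  assumes comp: "compact_space mtopology" and c: "c > 0"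
    and fin: "\<And>E F. closedin mtopology E \<Longrightarrow> closedin mtopology F \<Longrightarrow> E \<inter> F = {} \<Longrightarrow>
       finite {C \<in> connected_components_of mtopology. C \<inter> E \<noteq> {} \<and> C \<inter> F \<noteq> {}}"
  shows "finite {C \<in> connected_components_of mtopology. \<exists>x\<in>C. \<exists>y\<in>C. d x y > c}"
proof -
  have "mtotally_bounded M" using comp compact_space_eq_mcomplete_mtotally_bounded by blast
  then obtain Z where Z: "finite Z" "Z \<subseteq> M" "M \<subseteq> (\<Union>z\<in>Z. mball z (c/4))"
    unfolding mtotally_bounded_def using c by (metis divide_pos_pos zero_less_numeral)
  define J where "J = {(y, z) \<in> Z \<times> Z. mcball y (c/4) \<inter> mcball z (c/4) = {}}"
  have J: "finite J" unfolding J_def using Z(1) by (auto intro: finite_subset[of _ "Z \<times> Z"])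
  let ?F = "\<lambda>p. {C \<in> connected_components_of mtopology. C \<inter> mcball (fst p) (c/4) \<noteq> {} \<and> C \<inter> mcball (snd p) (c/4) \<noteq> {}}"
  have "finite (\<Union>p\<in>J. ?F p)"
  proof (intro finite_UN_I J)
    fix p assume "p \<in> J"
    then show "finite (?F p)" unfolding J_def by (intro fin) auto
  qed
  moreover have "{C \<in> connected_components_of mtopology. \<exists>x\<in>C. \<exists>y\<in>C. d x y > c} \<subseteq> (\<Union>p\<in>J. ?F p)"
  proof
    fix C assume "C \<in> {C \<in> connected_components_of mtopology. \<exists>x\<in>C. \<exists>y\<in>C. d x y > c}"
    then obtain x y where C: "C \<in> connected_components_of mtopology" "x \<in> C" "y \<in> C" "d x y > c" by auto
    have xy: "x \<in> M" "y \<in> M" using C connected_components_of_subset by fastforce+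
    obtain u where u: "u \<in> Z" "x \<in> mball u (c/4)" using xy(1) Z(3) by blast
    obtain v where v: "v \<in> Z" "y \<in> mball v (c/4)" using xy(2) Z(3) by blast
    have "mcball u (c/4) \<inter> mcball v (c/4) = {}"
    proof (rule ccontr)
      assume "\<not> ?thesis"
      then obtain w where w: "w \<in> mcball u (c/4)" "w \<in> mcball v (c/4)" by blast
      have M: "u \<in> M" "v \<in> M" "w \<in> M" using w by (auto simp: in_mcball)
      have "d x y \<le> d x u + d u w + d w v + d v y"
        using triangle[of x u y] triangle[of u w y] triangle[of w v y] M xy by linarith
      moreover have "d u x < c/4" "d v y < c/4" "d u w \<le> c/4" "d v w \<le> c/4"
        using u v w by (auto simp: in_mball in_mcball)
      ultimately show False using C(4) commute[of x u] commute[of w v] by linarith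
    qed
    then have "(u, v) \<in> J" using u v unfolding J_def by auto
    moreover have "x \<in> mcball u (c/4)" "y \<in> mcball v (c/4)" using u v mball_subset_mcball by blast+
    then have "C \<in> ?F (u, v)" using C by auto
    ultimately show "C \<in> (\<Union>p\<in>J. ?F p)" by blast
  qed
  ultimately show ?thesis using finite_subset by blast
qed

text \<open>Boundary bumping is applied within \<open>C\<close>, which requires
  \<open>C \<inter> mcball x s\<close> to be a proper subset. If it is all of \<open>C\<close>, then
  \<open>C\<close> itself lies in \<open>Q\<close> and leaves the open ball by assumption.\<close>

lemma component_bumps_sphere:
  assumes comp: "compact_space mtopology" and C: "C \<in> connected_components_of mtopology"
    and y: "y \<in> C" "d x y \<le> s" "x \<in> M" and far: "\<not> C \<subseteq> mball x s"
    and Q: "Q \<in> connected_components_of (subtopology mtopology (mcball x s))" "y \<in> Q"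
  shows "Q \<inter> (M - mball x s) \<noteq> {}"
proof -
  have CM: "C \<subseteq> M" using connected_components_of_subset[OF C] by simp
  have conn: "connectedin mtopology C" using C connectedin_connected_components_of by blast
  have clC: "closedin mtopology C" using C closedin_connected_components_of by blast
  show ?thesis
  proof (cases "C \<subseteq> mcball x s")
    case True
    then have "connectedin (subtopology mtopology (mcball x s)) C"
      using conn by (simp add: connectedin_subtopology)
    then have "C \<subseteq> Q" using connected_components_of_maximal[OF Q(1)] y(1) Q(2) by (meson disjnt_iff)
    then show ?thesis using far CM by blast
  next
    case False
    let ?X = "subtopology mtopology C"
    have tX: "topspace ?X = C" using CM by auto
    have X: "connected_space ?X" "compact_space ?X" "Hausdorff_space ?X"
      subgoal using conn unfolding connectedin_def by simp
      subgoal using closedin_compact_space[OF comp clC] by (rule compact_space_subtopology)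
      subgoal by (simp add: Hausdorff_space_mtopology Hausdorff_space_subtopology)
      done
    let ?S = "C \<inter> mcball x s"
    have S: "closedin ?X ?S" by (intro closedin_subtopology_Int_closed closedin_mcball)
    have SC: "?S \<noteq> topspace ?X" using False tX by auto
    have yS: "y \<in> ?S" using y CM by (auto simp: in_mcball)
    let ?R = "connected_component_of_set (subtopology ?X ?S) y"
    have yt: "y \<in> topspace (subtopology ?X ?S)" using yS tX by auto
    have R: "?R \<in> connected_components_of (subtopology ?X ?S)"
      using yt connected_component_in_connected_components_of by metis
    obtain q where q: "q \<in> ?R" "q \<in> ?X frontier_of ?S"
      using boundary_bumping_theorem_closed[OF X S SC R] by auto
    have "connectedin (subtopology ?X ?S) ?R" by (rule connectedin_connected_component_of)
    then have cR: "connectedin mtopology ?R" "?R \<subseteq> ?S" by (auto simp: connectedin_subtopology)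
    then have "connectedin (subtopology mtopology (mcball x s)) ?R" by (simp add: connectedin_subtopology)
    moreover have "y \<in> ?R" using yt by (simp add: connected_component_of_refl)
    ultimately have RQ: "?R \<subseteq> Q" using connected_components_of_maximal[OF Q(1)] Q(2) by (meson disjnt_iff)
    have "openin ?X (C \<inter> mball x s)" by (intro openin_subtopology_Int2 openin_mball)
    moreover have "C \<inter> mball x s \<subseteq> ?S" using mball_subset_mcball by auto
    ultimately have "C \<inter> mball x s \<subseteq> ?X interior_of ?S" by (simp add: interior_of_maximal)
    then have "q \<notin> C \<inter> mball x s" using q(2) unfolding frontier_of_def by auto
    moreover have "q \<in> C" using q cR by auto
    ultimately have "q \<in> M - mball x s" using CM by auto
    then show ?thesis using q(1) RQ by auto
  qed
qed

text \<open>It is enough to connect nearby points to \<open>x\<close> by small connected sets.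
  Components of a ball about \<open>x\<close> that come close to \<open>x\<close> reach the boundary
  sphere by bumping, hence are finite in number, and those missing \<open>x\<close> can be cut away
  from a neighbourhood of \<open>x\<close>.\<close>

lemma locally_connected_component:
  assumes comp: "compact_space mtopology" and C: "C \<in> connected_components_of mtopology"
    and fin: "\<And>E F V. closedin mtopology E \<Longrightarrow> closedin mtopology F \<Longrightarrow> E \<inter> F = {} \<Longrightarrow> openin mtopology V \<Longrightarrow> V \<subseteq> F \<Longrightarrow>
       finite {C \<in> connected_components_of (subtopology mtopology (M - V)). C \<inter> E \<noteq> {} \<and> C \<inter> F \<noteq> {}}"
  shows "locally_connected_space (subtopology mtopology C)"
  unfolding locally_connected_space_im_kleinen
proof (intro allI impI, elim conjE)
  fix V x assume V: "openin (subtopology mtopology C) V" and xV: "x \<in> V"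
  have CM: "C \<subseteq> M" using connected_components_of_subset[OF C] by simp
  have conn: "connectedin mtopology C" using C connectedin_connected_components_of by blast
  obtain T where T: "openin mtopology T" "V = T \<inter> C" using V by (auto simp: openin_subtopology)
  have x: "x \<in> C" "x \<in> M" "x \<in> T" using xV T CM by auto
  obtain R where R: "R > 0" "mball x R \<subseteq> T" using T(1) x(3) openin_mtopology by blast
  \<comment> \<open>With \<open>2 * r < R\<close> even the closed ball of radius
    \<open>2 * r\<close> lies in \<open>T\<close>.\<close>
  define r where "r = R / 3"
  have r: "r > 0" "2 * r < R" using R by (auto simp: r_def)
  have sub: "mcball x (2*r) \<subseteq> T" using R(2) r(2) by (force simp: in_mball in_mcball)
  show "\<exists>U. openin (subtopology mtopology C) U \<and> x \<in> U \<and> U \<subseteq> V \<and>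
          (\<forall>y\<in>U. \<exists>Ca. connectedin (subtopology mtopology C) Ca \<and> Ca \<subseteq> V \<and> x \<in> Ca \<and> y \<in> Ca)"
  proof (cases "C \<subseteq> mball x (2*r)")
    case True
    then have "V = C" using T sub mball_subset_mcball by blast
    then show ?thesis using V xV conn by (intro exI[of _ V]) (auto simp: connectedin_subtopology)
  next
    case False
    \<comment> \<open>Removing \<open>?W\<close> leaves exactly the closed ball, and
      \<open>?W\<close> lies in the closed set \<open>?F\<close>, the complement of the open ball,
      as \<open>fin\<close> requires.\<close>
    let ?W = "M - mcball x (2*r)"
    let ?F = "M - mball x (2*r)"
    let ?E = "mcball x r"
    have Weq: "M - ?W = mcball x (2*r)" using mcball_subset_mspace by blast
    define \<Y> where "\<Y> = {P \<in> connected_components_of (subtopology mtopology (M - ?W)). P \<inter> ?E \<noteq> {} \<and> P \<inter> ?F \<noteq> {}}"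
    have finY: "finite \<Y>"
      unfolding \<Y>_def
    proof (rule fin)
      show "closedin mtopology ?F" by (metis closedin_def Diff_subset openin_mball topspace_mtopology closedin_topspace closedin_diff)
      show "openin mtopology ?W" by (metis closedin_mcball closedin_def topspace_mtopology)
      show "?E \<inter> ?F = {}" using r by (auto simp: in_mball in_mcball)
      show "?W \<subseteq> ?F" using mball_subset_mcball by blast
    qed auto
    \<comment> \<open>The discarded components are finitely many closed sets, so \<open>U\<close> is
      open in \<open>C\<close>. A point of \<open>U\<close> then lies in a crossing component of the
      ball only if \<open>x\<close> does.\<close>
    define U where "U = C \<inter> (mball x r - \<Union>{P \<in> \<Y>. x \<notin> P})"
    have clP: "closedin mtopology P" if "P \<in> \<Y>" for P
    proof -
      have "closedin (subtopology mtopology (mcball x (2*r))) P"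
        using that closedin_connected_components_of unfolding \<Y>_def Weq by blast
      then show ?thesis using closedin_mcball closedin_trans_full by blast
    qed
    have "closedin mtopology (\<Union>{P \<in> \<Y>. x \<notin> P})"
      using finY clP by (intro closedin_Union) auto
    then have "openin mtopology (mball x r - \<Union>{P \<in> \<Y>. x \<notin> P})"
      by (intro openin_diff) auto
    then have opU: "openin (subtopology mtopology C) U"
      unfolding U_def by (metis openin_subtopology_Int2)
    have xU: "x \<in> U" using x r unfolding U_def by auto
    have UV: "U \<subseteq> V" unfolding U_def T(2) using sub r by (force simp: in_mball in_mcball)
    have "\<exists>Ca. connectedin (subtopology mtopology C) Ca \<and> Ca \<subseteq> V \<and> x \<in> Ca \<and> y \<in> Ca" if y: "y \<in> U" for y
    proof -
      have yC: "y \<in> C" "y \<in> mball x r" "\<And>P. P \<in> \<Y> \<Longrightarrow> y \<in> P \<Longrightarrow> x \<in> P" using y unfolding U_def by auto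
      have yE: "y \<in> ?E" "d x y \<le> 2*r" using yC(2) r by (auto simp: in_mball in_mcball)
      have ym: "y \<in> topspace (subtopology mtopology (mcball x (2*r)))" using yE yC(2) by (auto simp: in_mcball in_mball)
      define Q where "Q = connected_component_of_set (subtopology mtopology (mcball x (2*r))) y"
      have Q: "Q \<in> connected_components_of (subtopology mtopology (mcball x (2*r)))"
        unfolding Q_def using ym connected_component_in_connected_components_of by metis
      have yQ: "y \<in> Q" unfolding Q_def using ym by (simp add: connected_component_of_refl)
      have "Q \<inter> ?F \<noteq> {}" by (rule component_bumps_sphere[OF comp C yC(1) yE(2) x(2) False Q yQ])
      then have "Q \<in> \<Y>" using Q yQ yE unfolding \<Y>_def Weq by auto
      then have xQ: "x \<in> Q" using yC(3) yQ by blast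
      have cQ: "connectedin mtopology Q" "Q \<subseteq> mcball x (2*r)"
        using connectedin_connected_components_of[OF Q] by (auto simp: connectedin_subtopology)
      have "Q \<subseteq> C" using connected_components_of_maximal[OF C cQ(1)] x(1) xQ by (meson disjnt_iff)
      then show ?thesis
        using cQ sub T(2) xQ yQ by (intro exI[of _ Q]) (auto simp: connectedin_subtopology)
    qed
    then show ?thesis using opU xU UV by blast
  qed
qed

end

subsection \<open>The quotient space\<close>

locale monotone_decomposition_of_compactum =
  fixes K :: "'a::euclidean_space set" and D :: "'a set set"
  assumes compact_K: "compact K" and decomp: "monotone_decomposition K D"
begin

abbreviation "\<pi> \<equiv> decomp_proj D"
abbreviation "X \<equiv> decomp_topology K D"

lemma Union_D: "\<Union>D = K"
  using decomp unfolding monotone_decomposition_def by simp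

lemma disjoint:
  assumes "d \<in> D" "e \<in> D" "x \<in> d" "x \<in> e"
  shows "d = e"
proof -
  have "\<forall>d\<in>D. \<forall>e\<in>D. d \<noteq> e \<longrightarrow> d \<inter> e = {}"
    using decomp unfolding monotone_decomposition_def by simp
  then show ?thesis using assms by auto
qed

lemma continuum: "d \<in> D \<Longrightarrow> continuum d"
  using decomp unfolding monotone_decomposition_def by simp

lemma openin_saturation:
  assumes "openin (top_of_set K) U"
  shows "openin (top_of_set K) (\<Union>{e \<in> D. e \<subseteq> U})"
proof (cases "{e \<in> D. e \<subseteq> U} = {}")
  case False
  then obtain d where "d \<in> D" "d \<subseteq> U" by blast
  then show ?thesis using decomp assms unfolding monotone_decomposition_def by blast
next
  case True
  show ?thesis unfolding True by simp
qed

lemma proj_eq: "d \<in> D \<Longrightarrow> x \<in> d \<Longrightarrow> \<pi> x = d"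
  unfolding decomp_proj_def by (rule the_equality) (auto dest: disjoint)

lemma proj: assumes "x \<in> K" shows "\<pi> x \<in> D" "x \<in> \<pi> x"
proof -
  obtain d where d: "d \<in> D" "x \<in> d" using assms Union_D by blast
  then show "\<pi> x \<in> D" "x \<in> \<pi> x" using proj_eq[OF d] by auto
qed

lemma D_subset: "d \<in> D \<Longrightarrow> d \<subseteq> K" using Union_D by auto

lemma D_compact: "d \<in> D \<Longrightarrow> compact d" and D_connected: "d \<in> D \<Longrightarrow> connected d" and D_nonempty: "d \<in> D \<Longrightarrow> d \<noteq> {}"
  using continuum unfolding continuum_def by auto

lemma fibre: "d \<in> D \<Longrightarrow> {x \<in> K. \<pi> x = d} = d"
proof (intro set_eqI iffI)
  show "x \<in> d" if "x \<in> {x \<in> K. \<pi> x = d}" for x using that proj(2)[of x] by auto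
  show "x \<in> {x \<in> K. \<pi> x = d}" if "d \<in> D" "x \<in> d" for x using that proj_eq[of d x] D_subset[of d] by auto
qed

lemma proj_image: "\<pi> ` K = D"
proof
  show "\<pi> ` K \<subseteq> D" using proj(1) by auto
  show "D \<subseteq> \<pi> ` K"
  proof
    fix d assume d: "d \<in> D"
    then obtain x where "x \<in> d" using D_nonempty[OF d] by auto
    then have "x \<in> K" "\<pi> x = d" using D_subset[OF d] proj_eq[OF d] by auto
    then show "d \<in> \<pi> ` K" by blast
  qed
qed

lemma topspace_X: "topspace X = D"
proof -
  have "{x \<in> K. \<pi> x \<in> D} = K" using proj(1) by auto
  then have "openin X D" unfolding openin_decomp_topology by simp
  then show ?thesis
    using openin_subset[of X D] openin_topspace[of X] unfolding openin_decomp_topology by auto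
qed

lemma quotient: "quotient_map (top_of_set K) X \<pi>"
  unfolding quotient_map_def topspace_X openin_decomp_topology using proj_image by simp

lemma continuous_proj: "continuous_map (top_of_set K) X \<pi>"
  using quotient quotient_imp_continuous_map by blast

lemma monotone_proj: "monotone_map (top_of_set K) X \<pi>"
  unfolding monotone_map_def topspace_X
  using proj_image fibre D_connected D_subset by (auto simp: connectedin_subtopology)

lemma openin_X_saturation:
  assumes "openin (top_of_set K) U"
  shows "openin X {e \<in> D. e \<subseteq> U}"
proof -
  have "{x \<in> K. \<pi> x \<in> {e \<in> D. e \<subseteq> U}} = \<Union>{e \<in> D. e \<subseteq> U}"
  proof (intro set_eqI iffI)
    fix x assume "x \<in> {x \<in> K. \<pi> x \<in> {e \<in> D. e \<subseteq> U}}"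
    then show "x \<in> \<Union>{e \<in> D. e \<subseteq> U}" using proj[of x] by auto
  next
    fix x assume "x \<in> \<Union>{e \<in> D. e \<subseteq> U}"
    then obtain e where e: "e \<in> D" "e \<subseteq> U" "x \<in> e" by auto
    then show "x \<in> {x \<in> K. \<pi> x \<in> {e \<in> D. e \<subseteq> U}}"
      using proj_eq[OF e(1,3)] D_subset[OF e(1)] by auto
  qed
  then show ?thesis unfolding openin_decomp_topology using openin_saturation[OF assms] by auto
qed

text \<open>Upper semicontinuity in another form: the complement of the image of \<open>C\<close>
  consists of the elements contained in the open set \<open>K - C\<close>.\<close>

lemma closed_proj: "closed_map (top_of_set K) X \<pi>"
  unfolding closed_map_def
proof (intro allI impI)
  fix C assume C: "closedin (top_of_set K) C"
  then have CK: "C \<subseteq> K" using closedin_imp_subset by blast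
  have op: "openin (top_of_set K) (K - C)" using C by (simp add: openin_diff)
  have "D - \<pi> ` C = {e \<in> D. e \<subseteq> K - C}"
  proof (intro set_eqI iffI)
    fix e assume e: "e \<in> D - \<pi> ` C"
    have "x \<in> K - C" if "x \<in> e" for x
      using D_subset[of e] proj_eq[of e x] e that by auto
    then show "e \<in> {e \<in> D. e \<subseteq> K - C}" using e by auto
  next
    fix e assume e: "e \<in> {e \<in> D. e \<subseteq> K - C}"
    have "\<pi> c \<noteq> e" if "c \<in> C" for c
      using proj(2)[of c] CK e that by auto
    then show "e \<in> D - \<pi> ` C" using e by auto
  qed
  then show "closedin X (\<pi> ` C)"
    unfolding closedin_def topspace_X using openin_X_saturation[OF op] image_mono[OF CK, of \<pi>] proj_image by simp
qed

lemma compact_X: "compact_space X"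
proof -
  have "compactin (top_of_set K) K" using compact_K by (simp add: compactin_subtopology)
  then have "compactin X D" using image_compactin[OF _ continuous_proj] proj_image by metis
  then show ?thesis unfolding compact_space_def topspace_X .
qed

lemma Hausdorff_X: "Hausdorff_space X"
  unfolding Hausdorff_space_def topspace_X
proof (intro allI impI, elim conjE)
  fix d e assume de: "d \<in> D" "e \<in> D" "d \<noteq> e"
  then have "d \<inter> e = {}" using disjoint[OF de(1,2)] by auto
  then obtain U V where UV: "open U" "open V" "d \<subseteq> U" "e \<subseteq> V" "U \<inter> V = {}"
    using separation_normal_compact[OF D_compact[OF de(1)]] D_compact[OF de(2)] compact_imp_closed by metis
  have op: "openin X {c \<in> D. c \<subseteq> K \<inter> U}" "openin X {c \<in> D. c \<subseteq> K \<inter> V}"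
    using openin_X_saturation openin_open_Int UV(1,2) by metis+
  have "{c \<in> D. c \<subseteq> K \<inter> U} \<inter> {c \<in> D. c \<subseteq> K \<inter> V} = {}"
  proof -
    have "False" if "c \<in> D" "c \<subseteq> U" "c \<subseteq> V" for c
      using that UV(5) D_nonempty[OF that(1)] by blast
    then show ?thesis by auto
  qed
  moreover have "d \<in> {c \<in> D. c \<subseteq> K \<inter> U}" "e \<in> {c \<in> D. c \<subseteq> K \<inter> V}"
    using UV(3,4) D_subset[OF de(1)] D_subset[OF de(2)] de(1,2) by auto
  ultimately show "\<exists>U V. openin X U \<and> openin X V \<and> d \<in> U \<and> e \<in> V \<and> disjnt U V"
    using op unfolding disjnt_def by blast
qed

text \<open>A basic open set need not contain a whole element of \<open>D\<close>, but elements are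
  compact, so finite unions of basic sets do, and there are countably many of these.\<close>

lemma second_countable_X: "second_countable X"
proof -
  obtain B :: "'a set set" where B: "countable B" "topological_basis B"
    using ex_countable_basis by blast
  define \<F> where "\<F> = Union ` {F. finite F \<and> F \<subseteq> B}"
  define \<U> where "\<U> = (\<lambda>A. {e \<in> D. e \<subseteq> K \<inter> A}) ` \<F>"
  have "countable \<U>" unfolding \<U>_def \<F>_def
    using B(1) by (auto intro!: countable_image countable_Collect_finite_subset)
  moreover have "openin X V" if "V \<in> \<U>" for V
  proof -
    obtain F where F: "F \<subseteq> B" "V = {e \<in> D. e \<subseteq> K \<inter> \<Union>F}" using \<open>V \<in> \<U>\<close> unfolding \<U>_def \<F>_def by blast
    have "open (\<Union>F)" using F(1) B(2) topological_basis_open by blast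
    then show ?thesis unfolding F(2) by (intro openin_X_saturation openin_open_Int)
  qed
  moreover have "\<exists>V\<in>\<U>. d \<in> V \<and> V \<subseteq> U" if U: "openin X U" "d \<in> U" for U d
  proof -
    have UD: "U \<subseteq> D" and op: "openin (top_of_set K) {x \<in> K. \<pi> x \<in> U}"
      using U(1) unfolding openin_decomp_topology by auto
    obtain T where T: "open T" "{x \<in> K. \<pi> x \<in> U} = K \<inter> T" using op by (auto simp: openin_open)
    have d: "d \<in> D" using U UD by blast
    have dT: "d \<subseteq> T"
    proof
      fix x assume "x \<in> d"
      then have "x \<in> {x \<in> K. \<pi> x \<in> U}" using proj_eq[OF d] D_subset[OF d] U(2) by auto
      then show "x \<in> T" using T(2) by auto
    qed
    obtain B' where B': "B' \<subseteq> B" "\<Union>B' = T" using B(2) T(1) unfolding topological_basis_def by blast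
    have "\<And>S. S \<in> B' \<Longrightarrow> open S" using B' B(2) topological_basis_open by blast
    then obtain F where F: "F \<subseteq> B'" "finite F" "d \<subseteq> \<Union>F"
      using compactE[OF D_compact[OF d], of B'] dT B'(2) by metis
    have "{e \<in> D. e \<subseteq> K \<inter> \<Union>F} \<in> \<U>" unfolding \<U>_def \<F>_def using F B' by blast
    moreover have "d \<in> {e \<in> D. e \<subseteq> K \<inter> \<Union>F}" using d F D_subset by blast
    moreover have "{e \<in> D. e \<subseteq> K \<inter> \<Union>F} \<subseteq> U"
    proof
      fix e assume e: "e \<in> {e \<in> D. e \<subseteq> K \<inter> \<Union>F}"
      then obtain x where x: "x \<in> e" using D_nonempty by blast
      then have "x \<in> K \<inter> T" using e F(1) B'(2) by blast
      then have "\<pi> x \<in> U" using T(2) by blast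
      then show "e \<in> U" using proj_eq[of e x] e x by simp
    qed
    ultimately show ?thesis by (intro bexI[of _ "{e \<in> D. e \<subseteq> K \<inter> \<Union>F}"] conjI)
  qed
  ultimately show ?thesis unfolding second_countable_def by (intro exI[of _ \<U>]) simp
qed

lemma metrizable_X: "metrizable_space X"
  by (rule metrizable_space_compact_second_countable[OF compact_X Hausdorff_X second_countable_X])

text \<open>Here connectedness of the elements of \<open>D\<close> enters: preimages of connected
  sets under a closed map with connected fibres are connected.\<close>

lemma connected_preimage:
  assumes "connectedin X C"
  shows "connected {x \<in> K. \<pi> x \<in> C}"
proof -
  have "connectedin (top_of_set K) {x \<in> topspace (top_of_set K). \<pi> x \<in> C}"
    using monotone_closed_map[OF continuous_proj closed_proj] monotone_proj proj_image topspace_X assms by simp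
  then show ?thesis by (simp add: connectedin_subtopology)
qed

lemma connectedin_image:
  assumes "connected C" "C \<subseteq> K"
  shows "connectedin X (\<pi> ` C)"
  using assms by (intro connectedin_continuous_map_image[OF continuous_proj]) (simp add: connectedin_subtopology)

text \<open>The preimage of a crossing component \<open>C\<close> is connected, so it lies in a
  crossing component \<open>P\<close> upstairs. The image of \<open>P\<close> is connected and falls
  back into \<open>C\<close>, so the finitely many images refine the family to be counted.\<close>

lemma finite_crossings_quotient:
  assumes fc: "finite_crossings K" and S: "\<forall>d\<in>D. S_closed K d"
    and E: "closedin X E" and F: "closedin X F" and EF: "E \<inter> F = {}" and V: "openin X V" "V \<subseteq> F"
  shows "finite {C \<in> connected_components_of (subtopology X (D - V)). C \<inter> E \<noteq> {} \<and> C \<inter> F \<noteq> {}}"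
    (is "finite ?Q")
proof -
  have "normal_space X" using compact_X Hausdorff_X compact_Hausdorff_or_regular_imp_normal_space by blast
  then obtain G H where GH: "openin X G" "openin X H" "E \<subseteq> G" "F \<subseteq> H" "disjnt G H"
    using E F EF unfolding normal_space_def disjnt_def by metis
  define pre where "pre A = {x \<in> K. \<pi> x \<in> A}" for A
  have pre_open: "openin (top_of_set K) (pre A)" if "openin X A" for A
    using that unfolding pre_def openin_decomp_topology by simp
  have pre_compact: "compact (pre A)" if "closedin X A" for A
  proof -
    have "closedin (top_of_set K) {x \<in> topspace (top_of_set K). \<pi> x \<in> A}"
      using closedin_continuous_map_preimage[OF continuous_proj that] .
    then show ?thesis using compact_K closedin_compact unfolding pre_def by auto
  qed
  have fin: "finite {P \<in> components (K - pre V). P \<inter> pre E \<noteq> {} \<and> P \<inter> pre F \<noteq> {}}" (is "finite ?P")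
  proof (rule fc[unfolded finite_crossings_def, rule_format])
    show "openin (top_of_set K) (pre G)" "openin (top_of_set K) (pre H)" "openin (top_of_set K) (pre V)"
      using pre_open GH V by auto
    show "compact (pre E)" "compact (pre F)" using pre_compact E F by auto
    show "pre G \<inter> pre H = {}" using GH(5) unfolding pre_def disjnt_def by auto
    show "pre E \<subseteq> pre G" "pre F \<subseteq> pre H" "pre V \<subseteq> pre F" using GH V unfolding pre_def by auto
    fix x y assume x: "x \<in> pre G" and y: "y \<in> pre H"
    \<comment> \<open>Since the elements are S-closed, related points share an element, while
      \<open>G\<close> and \<open>H\<close> are disjoint sets of elements.\<close>
    show "y \<notin> S_set K x"
    proof
      assume yS: "y \<in> S_set K x"
      have xK: "x \<in> K" "\<pi> x \<in> G" "y \<in> K" "\<pi> y \<in> H" using x y unfolding pre_def by auto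
      have "y \<in> S_of_set K (\<pi> x)" unfolding S_of_set_def using yS proj[OF xK(1)] by blast
      then have "y \<in> \<pi> x" using S proj(1)[OF xK(1)] unfolding S_closed_def by auto
      then have "\<pi> y = \<pi> x" using proj_eq[OF proj(1)[OF xK(1)]] by auto
      then show False using xK GH(5) unfolding disjnt_def by auto
    qed
  qed
  show ?thesis
  proof (rule finite_if_refined[of "(`) \<pi> ` ?P"])
    show "finite ((`) \<pi> ` ?P)" using fin by (rule finite_imageI)
    fix C assume C: "C \<in> ?Q"
    have C1: "C \<in> connected_components_of (subtopology X (D - V))" using C by simp
    have "connectedin (subtopology X (D - V)) C" using C1 by (rule connectedin_connected_components_of)
    then have C2: "connectedin X C" "C \<subseteq> D - V" by (auto simp: connectedin_subtopology)
    have conC: "connected (pre C)" unfolding pre_def by (rule connected_preimage[OF C2(1)])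
    have preC: "pre C \<subseteq> K - pre V" using C2(2) unfolding pre_def by auto
    have ne: "pre C \<inter> pre E \<noteq> {}" "pre C \<inter> pre F \<noteq> {}"
    proof -
      obtain c where c: "c \<in> C" "c \<in> E" using C by auto
      then have "c \<in> \<pi> ` K" using C2(2) proj_image by auto
      then obtain x where "x \<in> K" "\<pi> x = c" by auto
      then show "pre C \<inter> pre E \<noteq> {}" using c unfolding pre_def by auto
    next
      obtain c where c: "c \<in> C" "c \<in> F" using C by auto
      then have "c \<in> \<pi> ` K" using C2(2) proj_image by auto
      then obtain x where "x \<in> K" "\<pi> x = c" by auto
      then show "pre C \<inter> pre F \<noteq> {}" using c unfolding pre_def by auto
    qed
    have "K - pre V \<noteq> {}" using preC ne by auto
    then obtain P where P: "P \<in> components (K - pre V)" "pre C \<subseteq> P"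
      using exists_component_superset[OF preC _ conC] by auto
    have "P \<in> ?P" using P ne by auto
    have PK: "P \<subseteq> K - pre V" "connected P" using in_components_subset[OF P(1)] in_components_connected[OF P(1)] by auto
    have "connectedin X (\<pi> ` P)" using PK by (intro connectedin_image) auto
    moreover have "\<pi> ` P \<subseteq> D - V" using PK(1) proj(1) unfolding pre_def by auto
    ultimately have "connectedin (subtopology X (D - V)) (\<pi> ` P)" by (simp add: connectedin_subtopology)
    moreover have "\<not> disjnt C (\<pi> ` P)"
    proof -
      obtain x where "x \<in> pre C" using ne by auto
      then have "\<pi> x \<in> C" "\<pi> x \<in> \<pi> ` P" using P(2) unfolding pre_def by auto
      then show ?thesis unfolding disjnt_iff by metis
    qed
    ultimately have "\<pi> ` P \<subseteq> C" by (rule connected_components_of_maximal[OF C1])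
    moreover have "\<pi> ` P \<noteq> {}" using P ne by auto
    ultimately show "\<exists>R\<in>(`) \<pi> ` ?P. R \<noteq> {} \<and> R \<subseteq> C"
      using \<open>P \<in> ?P\<close> by (intro bexI[of _ "\<pi> ` P"] conjI imageI)
  next
    fix C C' assume "C \<in> ?Q" "C' \<in> ?Q" "C \<inter> C' \<noteq> {}"
    then show "C = C'" using connected_components_of_overlap[of C "subtopology X (D - V)" C'] by simp
  qed
qed

lemma peano_if_S_closed:
  assumes fc: "finite_crossings K" and S: "\<forall>d\<in>D. S_closed K d"
  shows "peano_space X"
proof -
  obtain M d where M: "Metric_space M d" "X = Metric_space.mtopology M d"
    using metrizable_X unfolding metrizable_space_def by metis
  interpret Metric_space M d by (rule M(1))
  have MD: "M = D" using topspace_X M(2) topspace_mtopology by simp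
  have comp: "compact_space mtopology" using compact_X M(2) by simp
  have fin: "finite {C \<in> connected_components_of (subtopology mtopology (M - V)). C \<inter> E \<noteq> {} \<and> C \<inter> F \<noteq> {}}"
    if "closedin mtopology E" "closedin mtopology F" "E \<inter> F = {}" "openin mtopology V" "V \<subseteq> F" for E F V
    using finite_crossings_quotient[OF fc S, of E F V] that unfolding MD M(2) by simp
  have fin0: "finite {C \<in> connected_components_of mtopology. C \<inter> E \<noteq> {} \<and> C \<inter> F \<noteq> {}}"
    if "closedin mtopology E" "closedin mtopology F" "E \<inter> F = {}" for E F
    using fin[of E F "{}"] that by simp
  have large: "\<forall>c>0. finite {C \<in> connected_components_of mtopology. \<exists>x\<in>C. \<exists>y\<in>C. d x y > c}"
    by (intro allI impI finitely_many_large_components[OF comp _ fin0])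
  \<comment> \<open>A nondegenerate component has two points at distance above some
    \<open>1 / Suc n\<close>, which gives a countable union of finite families.\<close>
  have "{C \<in> connected_components_of mtopology. \<not> (\<exists>a. C = {a})} \<subseteq>
     (\<Union>n. {C \<in> connected_components_of mtopology. \<exists>x\<in>C. \<exists>y\<in>C. d x y > 1 / Suc n})"
  proof
    fix C assume "C \<in> {C \<in> connected_components_of mtopology. \<not> (\<exists>a. C = {a})}"
    then have C: "C \<in> connected_components_of mtopology" "\<not> (\<exists>a. C = {a})" by auto
    have "C \<noteq> {}" using C(1) nonempty_connected_components_of by blast
    then obtain x y where xy: "x \<in> C" "y \<in> C" "x \<noteq> y" using C(2) by blast
    have "x \<in> M" "y \<in> M" using connected_components_of_subset[OF C(1)] xy by auto
    then have "d x y > 0" using xy(3) by simp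
    then obtain n where "1 / real (Suc n) < d x y" using nat_approx_posE by blast
    then show "C \<in> (\<Union>n. {C \<in> connected_components_of mtopology. \<exists>x\<in>C. \<exists>y\<in>C. d x y > 1 / Suc n})"
      using C(1) xy(1,2) by (intro UN_I[of n]) auto
  qed
  moreover have "countable (\<Union>n. {C \<in> connected_components_of mtopology. \<exists>x\<in>C. \<exists>y\<in>C. d x y > 1 / Suc n})"
  proof (rule countable_UN)
    show "countable {C \<in> connected_components_of mtopology. \<exists>x\<in>C. \<exists>y\<in>C. d x y > 1 / Suc n}" for n
      using large[rule_format, of "1 / real (Suc n)"] countable_finite by simp
  qed simp
  ultimately have cnt: "countable {C \<in> connected_components_of mtopology. \<not> (\<exists>a. C = {a})}"
    by (rule countable_subset)
  have lc: "locally_connected_space (subtopology mtopology C)" if "C \<in> connected_components_of mtopology" for C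
    by (rule locally_connected_component[OF comp that fin])
  show ?thesis
    unfolding peano_space_def M(2)
  proof (intro conjI exI[of _ M] exI[of _ d] ballI)
    show "metrizable_space mtopology" by (rule metrizable_space_mtopology)
  qed (rule comp cnt lc large M(1) refl, assumption?)+
qed

end

section \<open>From a Peano quotient to S-closed elements\<close>

lemma self_mem_S_set: "x \<in> K \<Longrightarrow> x \<in> S_set K x"
  unfolding S_set_def by auto

context monotone_decomposition_of_compactum
begin

lemma S_set_disjoint_if_peano:
  assumes P: "peano_space X" and a: "a \<in> D" and x: "x \<in> a" and y: "y \<in> K" "y \<notin> a"
  shows "y \<notin> S_set K x"
proof -
  have "\<exists>M d. Metric_space M d \<and> X = Metric_space.mtopology M d \<and>
      (\<forall>c>0. finite {C \<in> connected_components_of X. \<exists>x\<in>C. \<exists>y\<in>C. d x y > c})"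
    using P unfolding peano_space_def by (elim conjE)
  then obtain M d where M: "Metric_space M d" "X = Metric_space.mtopology M d"
    and large: "\<forall>c>0. finite {C \<in> connected_components_of X. \<exists>x\<in>C. \<exists>y\<in>C. d x y > c}"
    by (elim exE conjE)
  have lc: "locally_connected_space (subtopology X C)" if "C \<in> connected_components_of X" for C
    using P that unfolding peano_space_def by (elim conjE) (rule bspec)
  interpret Metric_space M d by (rule M(1))
  have MD: "M = D" using topspace_X M(2) topspace_mtopology by simp
  define b where "b = \<pi> y"
  have b: "b \<in> M" "y \<in> b" "a \<in> M" "a \<noteq> b" using proj[OF y(1)] a y(2) unfolding b_def MD by auto
  \<comment> \<open>A quarter of the distance keeps the \<open>\<epsilon>\<close>-balls about
    \<open>a\<close> and \<open>b\<close> disjoint and leaves room between them: points at distance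
    \<open>2 * \<epsilon>\<close> from \<open>a\<close> are at least as far from \<open>b\<close>,
    so even the \<open>\<epsilon>\<close>-balls around them avoid both.\<close>
  define \<epsilon> where "\<epsilon> = d a b / 4"
  have \<epsilon>: "\<epsilon> > 0" "d a b = 4 * \<epsilon>" using b unfolding \<epsilon>_def by auto
  have xK: "x \<in> K" "\<pi> x = a" using D_subset[OF a] proj_eq[OF a] x by auto
  have proj_M: "\<pi> z \<in> M" if "z \<in> K" for z using proj(1)[OF that] MD by simp
  define Ux where "Ux = {z \<in> K. \<pi> z \<in> mball a \<epsilon>}"
  define Uy where "Uy = {z \<in> K. \<pi> z \<in> mball b \<epsilon>}"
  have balls: "mball c r \<subseteq> D" for c r unfolding MD[symmetric] by (rule mball_subset_mspace)
  have opX: "openin X (mball c r)" for c r unfolding M(2) by simp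
  have op: "openin (top_of_set K) Ux" "openin (top_of_set K) Uy"
    using opX unfolding Ux_def Uy_def openin_decomp_topology by auto
  have apart: "d b w \<ge> 4 * \<epsilon> - d a w" if "w \<in> M" for w
    using triangle[of a w b] that b \<epsilon>(2) commute[of w b] by linarith
  have disj: "Ux \<inter> Uy = {}"
  proof -
    have False if z: "z \<in> K" "d a (\<pi> z) < \<epsilon>" "d b (\<pi> z) < \<epsilon>" for z
      using apart[OF proj_M[OF z(1)]] z \<epsilon> by linarith
    then show ?thesis unfolding Ux_def Uy_def by (auto simp: in_mball)
  qed
  have mem: "x \<in> Ux" "y \<in> Uy"
    using xK b \<epsilon> y(1) unfolding Ux_def Uy_def b_def by auto
  have fr: "top_of_set K frontier_of {z \<in> K. \<pi> z \<in> mball c \<epsilon>} \<subseteq> {z \<in> K. \<pi> z \<in> mcball c \<epsilon>}" for c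
  proof -
    have "closedin (top_of_set K) {z \<in> topspace (top_of_set K). \<pi> z \<in> mcball c \<epsilon>}"
      using closedin_continuous_map_preimage[OF continuous_proj] M(2) closedin_mcball by metis
    then have "top_of_set K closure_of {z \<in> K. \<pi> z \<in> mball c \<epsilon>} \<subseteq> {z \<in> K. \<pi> z \<in> mcball c \<epsilon>}"
      using mball_subset_mcball by (intro closure_of_minimal) auto
    then show ?thesis unfolding frontier_of_def by auto
  qed
  define \<P> where "\<P> = {P \<in> components (K - (Ux \<union> Uy)).
      P \<inter> (top_of_set K frontier_of Ux) \<noteq> {} \<and> P \<inter> (top_of_set K frontier_of Uy) \<noteq> {}}"
  have finP: "finite \<P>"
  proof (rule ccontr)
    assume inf: "infinite \<P>"
    have P: "P \<in> components (K - (Ux \<union> Uy))" "connected P" "P \<subseteq> K - (Ux \<union> Uy)" if "P \<in> \<P>" for P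
    proof -
      show 1: "P \<in> components (K - (Ux \<union> Uy))" using that unfolding \<P>_def by simp
      show "connected P" "P \<subseteq> K - (Ux \<union> Uy)" using in_components_connected[OF 1] in_components_subset[OF 1] by auto
    qed
    define \<C> where "\<C> = {C \<in> connected_components_of X. \<exists>x\<in>C. \<exists>y\<in>C. d x y > \<epsilon>}"
    have finC: "finite \<C>" using large \<epsilon>(1) unfolding \<C>_def by simp
    \<comment> \<open>The image of \<open>P\<close> has points within \<open>\<epsilon>\<close> of
      \<open>a\<close> and points at least \<open>3 * \<epsilon>\<close> from \<open>a\<close>. It
      therefore lies in one of the finitely many components of diameter above
      \<open>\<epsilon>\<close>, and being connected it meets the sphere of radius
      \<open>2 * \<epsilon>\<close> about \<open>a\<close>.\<close>
    have "\<forall>P\<in>\<P>. \<exists>C. C \<in> \<C> \<and> \<pi> ` P \<subseteq> C \<and> (\<exists>w. w \<in> \<pi> ` P \<and> d a w = 2 * \<epsilon>)"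
    proof
      fix P assume PP: "P \<in> \<P>"
      obtain u where u: "u \<in> P" "\<pi> u \<in> mcball a \<epsilon>" using PP fr[of a] unfolding \<P>_def Ux_def by blast
      obtain v where v: "v \<in> P" "\<pi> v \<in> mcball b \<epsilon>" using PP fr[of b] unfolding \<P>_def Uy_def by blast
      have PK: "P \<subseteq> K" using P(3)[OF PP] by auto
      have uv: "\<pi> u \<in> M" "\<pi> v \<in> M" using u(1) v(1) PK proj_M by auto
      have du: "d a (\<pi> u) \<le> \<epsilon>" and dv: "d a (\<pi> v) \<ge> 3 * \<epsilon>"
      proof -
        show "d a (\<pi> u) \<le> \<epsilon>" using u(2) by (simp add: in_mcball)
        have "d b (\<pi> v) \<le> \<epsilon>" using v(2) by (simp add: in_mcball)
        then show "d a (\<pi> v) \<ge> 3 * \<epsilon>" using apart[OF uv(2)] by linarith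
      qed
      have cP: "connectedin X (\<pi> ` P)" using P(2)[OF PP] PK by (rule connectedin_image)
      have ne: "X \<noteq> trivial_topology" using topspace_X a by auto
      obtain C where C: "C \<in> connected_components_of X" "\<pi> ` P \<subseteq> C"
        using exists_connected_component_of_superset[OF cP ne] by auto
      have "d (\<pi> u) (\<pi> v) > \<epsilon>" using triangle[OF b(3) uv] du dv \<epsilon>(1) by linarith
      then have "C \<in> \<C>" unfolding \<C>_def using C u(1) v(1) by auto
      moreover have "\<exists>w. w \<in> \<pi> ` P \<and> d a w = 2 * \<epsilon>"
      proof (rule ccontr)
        assume no: "\<not> ?thesis"
        have far: "openin X (M - mcball a (2 * \<epsilon>))"
          using closedin_mcball[of a "2 * \<epsilon>"] unfolding M(2) closedin_def by simp
        have "\<pi> ` P \<subseteq> mball a (2 * \<epsilon>) \<union> (M - mcball a (2 * \<epsilon>))"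
        proof
          fix w assume w: "w \<in> \<pi> ` P"
          then have "w \<in> M" using PK proj_M by auto
          moreover have "d a w \<noteq> 2 * \<epsilon>" using no w by auto
          ultimately show "w \<in> mball a (2 * \<epsilon>) \<union> (M - mcball a (2 * \<epsilon>))"
            using b(3) by (auto simp: in_mball in_mcball)
        qed
        moreover have "mball a (2 * \<epsilon>) \<inter> (M - mcball a (2 * \<epsilon>)) \<inter> \<pi> ` P = {}"
          using mball_subset_mcball by auto
        moreover have "\<pi> u \<in> mball a (2 * \<epsilon>)" using b(3) uv du \<epsilon>(1) by (simp add: in_mball)
        then have "mball a (2 * \<epsilon>) \<inter> \<pi> ` P \<noteq> {}" using u(1) by auto
        moreover have "\<pi> v \<in> M - mcball a (2 * \<epsilon>)" using b(3) uv dv \<epsilon>(1) by (simp add: in_mcball)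
        then have "(M - mcball a (2 * \<epsilon>)) \<inter> \<pi> ` P \<noteq> {}" using v(1) by auto
        ultimately show False using connectedinD[OF cP opX[of a "2 * \<epsilon>"] far] by simp
      qed
      ultimately show "\<exists>C. C \<in> \<C> \<and> \<pi> ` P \<subseteq> C \<and> (\<exists>w. w \<in> \<pi> ` P \<and> d a w = 2 * \<epsilon>)"
        using C(2) by (intro exI[of _ C] conjI)
    qed
    then obtain c where c: "\<forall>P\<in>\<P>. c P \<in> \<C> \<and> \<pi> ` P \<subseteq> c P \<and> (\<exists>w. w \<in> \<pi> ` P \<and> d a w = 2 * \<epsilon>)"
      by (rule bchoice[THEN exE])
    have "finite (c ` \<P>)" by (rule finite_subset[OF _ finC]) (use c in auto)
    then obtain P0 where P0: "P0 \<in> \<P>" "infinite {P \<in> \<P>. c P = c P0}"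
      using pigeonhole_infinite[OF inf] by auto
    define C where "C = c P0"
    define \<Q> where "\<Q> = {P \<in> \<P>. c P = C}"
    have infQ: "infinite \<Q>" using P0 unfolding \<Q>_def C_def by simp
    have C: "C \<in> connected_components_of X" using c P0(1) unfolding C_def \<C>_def by auto
    have Q: "Q \<in> \<P>" "\<pi> ` Q \<subseteq> C" if "Q \<in> \<Q>" for Q using that c unfolding \<Q>_def by auto
    have "\<forall>Q\<in>\<Q>. \<exists>w. w \<in> \<pi> ` Q \<and> d a w = 2 * \<epsilon>" using c Q(1) by auto
    then obtain w where w: "\<forall>Q\<in>\<Q>. w Q \<in> \<pi> ` Q \<and> d a (w Q) = 2 * \<epsilon>" by (rule bchoice[THEN exE])
    define W where "W = C \<inter> {z \<in> M. d a z = 2 * \<epsilon>}"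
    have clW: "closedin X W"
    proof -
      have "{z \<in> M. d a z = 2 * \<epsilon>} = mcball a (2 * \<epsilon>) - mball a (2 * \<epsilon>)"
        using b(3) by (auto simp: in_mball in_mcball)
      moreover have "closedin X (mcball a (2 * \<epsilon>) - mball a (2 * \<epsilon>))"
        unfolding M(2) by (intro closedin_diff closedin_mcball openin_mball)
      ultimately show ?thesis
        unfolding W_def using closedin_connected_components_of[OF C] by (auto intro: closedin_Int)
    qed
    then have compW: "compactin mtopology W"
      using compact_X closedin_compact_space unfolding M(2) by metis
    have CM: "C \<subseteq> M" using connected_components_of_subset[OF C] topspace_X MD by simp
    have wW: "w ` \<Q> \<subseteq> W"
    proof
      fix z assume "z \<in> w ` \<Q>"
      then obtain Q' where Q': "Q' \<in> \<Q>" "z = w Q'" by auto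
      then have "z \<in> \<pi> ` Q'" "d a z = 2 * \<epsilon>" using w by simp_all
      then show "z \<in> W" using Q(2)[OF Q'(1)] CM unfolding W_def by auto
    qed
    \<comment> \<open>This is the way back to \<open>K\<close>: by monotonicity a connected set of
      the quotient off both balls lifts to a connected set, which must lie in every component it
      meets.\<close>
    have absorb: "{z \<in> K. \<pi> z \<in> N} \<subseteq> Q"
      if N: "connectedin X N" "N \<inter> (mball a \<epsilon> \<union> mball b \<epsilon>) = {}" "w Q \<in> N" and QQ: "Q \<in> \<Q>" for N Q
    proof (rule components_maximal[OF P(1)[OF Q(1)[OF QQ]]])
      show "connected {z \<in> K. \<pi> z \<in> N}" by (rule connected_preimage[OF N(1)])
      show "{z \<in> K. \<pi> z \<in> N} \<subseteq> K - (Ux \<union> Uy)" using N(2) unfolding Ux_def Uy_def by auto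
      have "w Q \<in> \<pi> ` Q" using w QQ by simp
      then obtain z where z: "z \<in> Q" "\<pi> z = w Q" by auto
      then have "z \<in> K" using P(3)[OF Q(1)[OF QQ]] by auto
      then show "Q \<inter> {z \<in> K. \<pi> z \<in> N} \<noteq> {}" using z N(3) by auto
    qed
    have disjQ: "Q = Q'" if "Q \<in> \<Q>" "Q' \<in> \<Q>" "z \<in> Q" "z \<in> Q'" for Q Q' z
      using components_eq[OF P(1)[OF Q(1)[OF that(1)]] P(1)[OF Q(1)[OF that(2)]]] that(3,4) by auto
    \<comment> \<open>Distinct components upstairs could have overlapping images. Absorbing the
      singleton \<open>{w Q1}\<close> shows that its fibre lies in both components, so equal values
      of \<open>w\<close> force equal components.\<close>
    have injw: "inj_on w \<Q>"
    proof (rule inj_onI)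
      fix Q1 Q2 assume *: "Q1 \<in> \<Q>" "Q2 \<in> \<Q>" "w Q1 = w Q2"
      have wM: "w Q1 \<in> M" "d a (w Q1) = 2 * \<epsilon>" using wW *(1) unfolding W_def by auto
      have "d b (w Q1) \<ge> 2 * \<epsilon>" using apart[OF wM(1)] wM(2) by linarith
      then have av: "{w Q1} \<inter> (mball a \<epsilon> \<union> mball b \<epsilon>) = {}" using wM \<epsilon>(1) by (auto simp: in_mball)
      have cn: "connectedin X {w Q1}" using wM(1) topspace_X MD by simp
      have s: "{z \<in> K. \<pi> z \<in> {w Q1}} \<subseteq> Q1" "{z \<in> K. \<pi> z \<in> {w Q1}} \<subseteq> Q2"
        using absorb[OF cn av] * by auto
      have "w Q1 \<in> \<pi> ` Q1" using w *(1) by simp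
      then obtain z where "z \<in> Q1" "\<pi> z = w Q1" by auto
      then have "z \<in> Q1" "z \<in> Q2" using s(2) P(3)[OF Q(1)[OF *(1)]] by auto
      then show "Q1 = Q2" using disjQ *(1,2) by auto
    qed
    have "infinite (w ` \<Q>)" using infQ injw finite_imageD by auto
    then have "W \<inter> mtopology derived_set_of (w ` \<Q>) \<noteq> {}"
      using compactin_imp_Bolzano_Weierstrass[OF compW, of "w ` \<Q>"] wW by simp
    then obtain l where l: "l \<in> W" "l \<in> mtopology derived_set_of (w ` \<Q>)" by auto
    have lM: "l \<in> M" "l \<in> C" "d a l = 2 * \<epsilon>" using l(1) unfolding W_def by auto
    have lb: "d b l \<ge> 2 * \<epsilon>" using apart[OF lM(1)] lM(3) by linarith
    have opl: "openin (subtopology X C) (C \<inter> mball l \<epsilon>)" using opX by (intro openin_subtopology_Int2)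
    have lball: "l \<in> C \<inter> mball l \<epsilon>" using lM \<epsilon>(1) by simp
    obtain U where U: "openin (subtopology X C) U" "l \<in> U"
        and conn: "\<forall>z\<in>U. \<exists>N. connectedin (subtopology X C) N \<and> N \<subseteq> C \<inter> mball l \<epsilon> \<and> l \<in> N \<and> z \<in> N"
      using lc[OF C, unfolded locally_connected_space_im_kleinen, rule_format, OF conjI, OF opl lball] by (elim exE conjE)
    obtain T where T: "openin X T" "U = T \<inter> C" using U(1) by (auto simp: openin_subtopology)
    have "infinite (w ` \<Q> \<inter> T)"
      using l(2) T U(2) unfolding derived_set_of_infinite_openin_metric M(2) by auto
    \<comment> \<open>Near \<open>l\<close>, local connectedness joins each \<open>w Q\<close> to
      \<open>l\<close> by a connected set inside the \<open>\<epsilon>\<close>-ball. By absorption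
      every such \<open>Q\<close> contains the whole fibre of \<open>l\<close>, so there is only
      one, although \<open>l\<close> is a limit of infinitely many values of
      \<open>w\<close>.\<close>
    moreover have single: "z = z'" if z: "z \<in> w ` \<Q> \<inter> T" "z' \<in> w ` \<Q> \<inter> T" for z z'
    proof -
      have key: "{x \<in> K. \<pi> x \<in> {l}} \<subseteq> Q" if QQ: "Q \<in> \<Q>" "w Q \<in> T" for Q
      proof -
        have wU: "w Q \<in> U" using QQ wW T(2) unfolding W_def by auto
        obtain N where N: "connectedin (subtopology X C) N" "N \<subseteq> C \<inter> mball l \<epsilon>" "l \<in> N" "w Q \<in> N"
          using bspec[OF conn wU] by (elim exE conjE)
        have NX: "connectedin X N" using N(1) by (simp add: connectedin_subtopology)
        have "N \<inter> (mball a \<epsilon> \<union> mball b \<epsilon>) = {}"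
        proof -
          have False if v: "v \<in> N" "v \<in> mball c' \<epsilon>" "c' \<in> M" "d c' l \<ge> 2 * \<epsilon>" for v c'
          proof -
            have "d l v < \<epsilon>" "v \<in> M" using N(2) v(1) by (auto simp: in_mball)
            moreover have "d c' v < \<epsilon>" using v(2) by (simp add: in_mball)
            ultimately show False
              using triangle[OF v(3) \<open>v \<in> M\<close> lM(1)] commute[of v l] v(4) by linarith
          qed
          then have "\<And>v. v \<in> N \<Longrightarrow> v \<notin> mball a \<epsilon>" "\<And>v. v \<in> N \<Longrightarrow> v \<notin> mball b \<epsilon>"
            using b(1,3) lb lM(3) by (metis order_refl)+
          then show ?thesis by blast
        qed
        then have "{z \<in> K. \<pi> z \<in> N} \<subseteq> Q" using absorb[OF NX _ N(4) QQ(1)] by simp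
        then show ?thesis using N(3) by auto
      qed
      obtain Q1 Q2 where Q12: "Q1 \<in> \<Q>" "z = w Q1" "Q2 \<in> \<Q>" "z' = w Q2" using z by auto
      have "l \<in> \<pi> ` K" using lM(1) MD proj_image by simp
      then obtain t where t: "t \<in> K" "\<pi> t = l" by auto
      then have "t \<in> Q1" "t \<in> Q2" using key[of Q1] key[of Q2] Q12 z by auto
      then show ?thesis using disjQ Q12 by auto
    qed
    ultimately obtain z where "z \<in> w ` \<Q> \<inter> T" by (metis finite.emptyI all_not_in_conv)
    then have "w ` \<Q> \<inter> T \<subseteq> {z}" using single by auto
    then show False using \<open>infinite (w ` \<Q> \<inter> T)\<close> finite_subset by auto
  qed
  show ?thesis
    unfolding S_set_def
  proof (clarify, erule notE)
    show "\<exists>Ux Uy. openin (top_of_set K) Ux \<and> openin (top_of_set K) Uy \<and> Ux \<inter> Uy = {} \<and> x \<in> Ux \<and> y \<in> Uy \<and>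
       finite {C \<in> components (K - (Ux \<union> Uy)).
                 C \<inter> (top_of_set K frontier_of Ux) \<noteq> {} \<and> C \<inter> (top_of_set K frontier_of Uy) \<noteq> {}}"
      using op disj mem finP unfolding \<P>_def by (intro exI[of _ Ux] exI[of _ Uy] conjI)
  qed
qed

lemma S_closed_if_peano:
  assumes "peano_space X" "a \<in> D"
  shows "S_closed K a"
  unfolding S_closed_def
proof
  show "S_of_set K a \<subseteq> a"
  proof
    fix y assume "y \<in> S_of_set K a"
    then obtain x where x: "x \<in> a" "y \<in> S_set K x" unfolding S_of_set_def by auto
    then have "y \<in> K" unfolding S_set_def by simp
    then show "y \<in> a" using S_set_disjoint_if_peano[OF assms x(1)] x(2) by auto
  qed
  show "a \<subseteq> S_of_set K a"
    unfolding S_of_set_def using self_mem_S_set D_subset[OF assms(2)] by auto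
qed

end

theorem theorem9p6:
  fixes K :: "(real^3) set" and D :: "(real^3) set set"
  assumes "K \<subseteq> sphere 0 1" and "compact K"
    and "monotone_decomposition K D"
  shows "peano_space (decomp_topology K D) \<longleftrightarrow>
         (\<forall>d\<in>D. continuum d \<and> S_closed K d)"
proof -
  interpret monotone_decomposition_of_compactum K D using assms by unfold_locales
  show ?thesis
    using continuum S_closed_if_peano peano_if_S_closed[OF finite_crossings_sphere[OF assms(1,2)]] by auto
qed

end
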